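(* Let $X,Y$ be computable Banach spaces. Then $\mathsf{CGT}_{X,Y}\le_W\mathsf{C_{\mathbb N}}\equiv_W\mathsf{CGT}_{\ell^2,\ell^2}$.
   Context: A represented space is a pair $(X,\delta_X)$ with $\delta_X:\subseteq\mathbb N^{\mathbb N}\to X$ a partial surjection. For a partial multi-valued map $f:\subseteq X\rightrightarrows Y$ between represented spaces, a realizer of $f$ is a partial function $F:\subseteq\mathbb N^{\mathbb N}\to\mathbb N^{\mathbb N}$ with $\delta_Y(F(p))\in f(\delta_X(p))$ for all $p\in\mathrm{dom}(f\circ\delta_X)$. We write $f\le_W g$ (Weihrauch reducibility) if there are computable partial functions $H,K:\subseteq\mathbb N^{\mathbb N}\to\mathbb N^{\mathbb N}$ such that for every realizer $G$ of $g$ the function $p\mapsto H\langle p,G(K(p))\rangle$ is a realizer of $f$, where $\langle\cdot,\cdot\rangle$ is a standard computable pairing on $\mathbb N^{\mathbb N}$. $\equiv_W$ is the induced equivalence. $\mathcal A_-(\mathbb N)$ is the set of subsets of $\mathbb N$, where $p$ names $A$ iff $\mathbb N\setminus A=\{n:n+1\in\mathrm{range}(p)\}$; $\mathsf{C_{\mathbb N}}:\subseteq\mathcal A_-(\mathbb N)\rightrightarrows\mathbb N$, $A\mapsto A$, on non-empty $A$. A computable Banach space is a (real) Banach space together with a sequence whose linear span is dense, such that the induced metric space is a complete computable metric space; points are represented by the Cauchy representation $\delta_X$. $\mathcal C(X,Y)$ is the space of continuous $T:X\to Y$ with the function space representation $[\delta_X\to\delta_Y]$. For a computable metric space $Z$,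 $\mathcal A_+(Z)$ is the set of closed subsets of $Z$ represented by positive information: a name of $A$ is an enumeration of all rational open balls that intersect $A$. $\ell^2$ is the standard computable Hilbert space. $\mathsf{CGT}_{X,Y}:\subseteq\mathcal A_+(X\times Y)\to\mathcal C(X,Y)$, $\mathrm{graph}(T)\mapsto T$, defined on those closed $A\subseteq X\times Y$ with $A=\mathrm{graph}(T)$ for some linear bounded $T:X\to Y$. *)

theory Defs
  imports "HOL-Analysis.Analysis" "HOL-Library.Nat_Bijection"
begin

typedef l2 = "{x :: nat \<Rightarrow> real. summable (\<lambda>n. (x n)^2)}"
  morphisms l2_seq Abs_l2
  by (rule exI[of _ "\<lambda>_. 0"]) simp

setup_lifting type_definition_l2

lemma l2_summable: "summable (\<lambda>n. (l2_seq x n)^2)"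
  using l2_seq by auto

lemma summable_sq_add:
  fixes x y :: "nat \<Rightarrow> real"
  assumes "summable (\<lambda>n. (x n)^2)" "summable (\<lambda>n. (y n)^2)"
  shows "summable (\<lambda>n. (x n + y n)^2)"
proof (rule summable_comparison_test[of _ "\<lambda>n. 2 * (x n)^2 + 2 * (y n)^2"])
  show "\<exists>N. \<forall>n\<ge>N. norm ((x n + y n)^2) \<le> 2 * (x n)^2 + 2 * (y n)^2"
  proof (intro exI allI impI)
    fix n
    have "0 \<le> (x n - y n)^2" by simp
    then have "(x n + y n)^2 \<le> 2 * (x n)^2 + 2 * (y n)^2"
      by (simp add: power2_eq_square algebra_simps)
    then show "norm ((x n + y n)^2) \<le> 2 * (x n)^2 + 2 * (y n)^2"
      by simp
  qed
  show "summable (\<lambda>n. 2 * (x n)^2 + 2 * (y n)^2)"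
    using assms by (intro summable_add summable_mult)
qed

instantiation l2 :: real_vector
begin
lift_definition zero_l2 :: l2 is "\<lambda>_. 0" by simp
lift_definition plus_l2 :: "l2 \<Rightarrow> l2 \<Rightarrow> l2" is "\<lambda>x y n. x n + y n"
  by (simp add: summable_sq_add)
lift_definition uminus_l2 :: "l2 \<Rightarrow> l2" is "\<lambda>x n. - x n" by simp
lift_definition minus_l2 :: "l2 \<Rightarrow> l2 \<Rightarrow> l2" is "\<lambda>x y n. x n - y n"
proof -
  fix x y :: "nat \<Rightarrow> real"
  assume "summable (\<lambda>n. (x n)^2)" "summable (\<lambda>n. (y n)^2)"
  then have "summable (\<lambda>n. (x n + - y n)^2)" by (intro summable_sq_add) simp_all
  then show "summable (\<lambda>n. (x n - y n)^2)" by simp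
qed
lift_definition scaleR_l2 :: "real \<Rightarrow> l2 \<Rightarrow> l2" is "\<lambda>c x n. c * x n"
  by (simp add: power_mult_distrib summable_mult)
instance
  by standard (transfer; auto simp: algebra_simps)+
end

lemma l2_sum_le_suminf: "(\<Sum>n\<in>I. (l2_seq x n)^2) \<le> (\<Sum>n. (l2_seq x n)^2)" if "finite I"
  using that by (intro sum_le_suminf l2_summable) auto

instantiation l2 :: real_normed_vector
begin
lift_definition norm_l2 :: "l2 \<Rightarrow> real" is "\<lambda>x. sqrt (\<Sum>n. (x n)^2)" .
definition dist_l2 :: "l2 \<Rightarrow> l2 \<Rightarrow> real" where "dist_l2 x y = norm (x - y)"
definition sgn_l2 :: "l2 \<Rightarrow> l2" where "sgn_l2 x = x /\<^sub>R norm x"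
definition uniformity_l2 :: "(l2 \<times> l2) filter"
  where "uniformity_l2 = (INF e\<in>{0<..}. principal {(x, y). dist x y < e})"
definition open_l2 :: "l2 set \<Rightarrow> bool"
  where "open_l2 U \<longleftrightarrow> (\<forall>x\<in>U. \<forall>\<^sub>F (x', y) in uniformity. x' = x \<longrightarrow> y \<in> U)"
instance
proof
  fix x y :: l2 and a :: real
  show "dist x y = norm (x - y)" by (simp add: dist_l2_def)
  show "sgn x = x /\<^sub>R norm x" by (simp add: sgn_l2_def)
  show "(uniformity :: (l2 \<times> l2) filter) = (INF e\<in>{0<..}. principal {(x, y). dist x y < e})"
    by (simp add: uniformity_l2_def)
  show "open U \<longleftrightarrow> (\<forall>x\<in>U. \<forall>\<^sub>F (x', y) in uniformity. x' = x \<longrightarrow> y \<in> U)" for U :: "l2 set"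
    by (simp add: open_l2_def)
  show "(norm x = 0) = (x = 0)"
  proof transfer
    fix x :: "nat \<Rightarrow> real" assume s: "summable (\<lambda>n. (x n)^2)"
    have "sqrt (\<Sum>n. (x n)^2) = 0 \<longleftrightarrow> (\<Sum>n. (x n)^2) = 0" by simp
    also have "\<dots> \<longleftrightarrow> (\<forall>n. (x n)^2 = 0)" using s by (intro suminf_eq_zero_iff) auto
    also have "\<dots> \<longleftrightarrow> x = (\<lambda>_. 0)" by auto
    finally show "(sqrt (\<Sum>n. (x n)^2) = 0) = (x = (\<lambda>_. 0))" .
  qed
  show "norm (a *\<^sub>R x) = \<bar>a\<bar> * norm x"
  proof transfer
    fix a and x :: "nat \<Rightarrow> real" assume s: "summable (\<lambda>n. (x n)^2)"
    have "(\<Sum>n. (a * x n)^2) = a^2 * (\<Sum>n. (x n)^2)"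
      using suminf_mult[OF s, of "a^2"] by (simp add: power_mult_distrib)
    then show "sqrt (\<Sum>n. (a * x n)^2) = \<bar>a\<bar> * sqrt (\<Sum>n. (x n)^2)"
      by (simp add: real_sqrt_mult)
  qed
  show "norm (x + y) \<le> norm x + norm y"
  proof -
    have nx: "norm x = sqrt (\<Sum>n. (l2_seq x n)^2)" by transfer simp
    have ny: "norm y = sqrt (\<Sum>n. (l2_seq y n)^2)" by transfer simp
    have nxy: "norm (x + y) = sqrt (\<Sum>n. (l2_seq (x + y) n)^2)" by transfer simp
    have pl: "l2_seq (x + y) n = l2_seq x n + l2_seq y n" for n by transfer simp
    have "(\<Sum>n. (l2_seq (x + y) n)^2) \<le> (norm x + norm y)^2"
    proof (rule suminf_le_const[OF l2_summable])
      fix M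
      have "L2_set (l2_seq (x + y)) {..<M} \<le> L2_set (l2_seq x) {..<M} + L2_set (l2_seq y) {..<M}"
        unfolding pl[abs_def] by (rule L2_set_triangle_ineq)
      also have "L2_set (l2_seq x) {..<M} \<le> norm x"
        unfolding nx L2_set_def by (intro real_sqrt_le_mono l2_sum_le_suminf) auto
      also have "L2_set (l2_seq y) {..<M} \<le> norm y"
        unfolding ny L2_set_def by (intro real_sqrt_le_mono l2_sum_le_suminf) auto
      finally have f: "sqrt (\<Sum>n<M. (l2_seq (x + y) n)^2) \<le> norm x + norm y"
        by (simp add: L2_set_def)
      have nn: "0 \<le> (\<Sum>n<M. (l2_seq (x + y) n)^2)" by (intro sum_nonneg) auto
      have "(sqrt (\<Sum>n<M. (l2_seq (x + y) n)^2))^2 \<le> (norm x + norm y)^2"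
        by (rule power_mono[OF f]) (simp add: nn)
      then show "(\<Sum>n<M. (l2_seq (x + y) n)^2) \<le> (norm x + norm y)^2"
        using nn by simp
    qed
    then have "sqrt (\<Sum>n. (l2_seq (x + y) n)^2) \<le> sqrt ((norm x + norm y)^2)"
      by (rule real_sqrt_le_mono)
    also have "\<dots> = norm x + norm y" using nx ny by (simp add: suminf_nonneg l2_summable)
    finally show ?thesis using nxy by simp
  qed
qed
end

lemma norm_l2_eq: "norm x = sqrt (\<Sum>n. (l2_seq x n)^2)" by transfer simp
lemma l2_seq_minus: "l2_seq (x - y) n = l2_seq x n - l2_seq y n" by transfer simp

lemma l2_coord_le: "\<bar>l2_seq x n\<bar> \<le> norm x"
proof -
  have "(l2_seq x n)^2 \<le> (\<Sum>n. (l2_seq x n)^2)"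
    using l2_sum_le_suminf[of "{n}" x] by simp
  then have "sqrt ((l2_seq x n)^2) \<le> norm x" unfolding norm_l2_eq by (rule real_sqrt_le_mono)
  then show ?thesis by simp
qed

instance l2 :: banach
proof
  fix X :: "nat \<Rightarrow> l2" assume C: "Cauchy X"
  have "Cauchy (\<lambda>k. l2_seq (X k) n)" for n
  proof (rule metric_CauchyI)
    fix e :: real assume "0 < e"
    then obtain N where N: "\<forall>m\<ge>N. \<forall>k\<ge>N. norm (X m - X k) < e"
      using C by (auto simp: Cauchy_iff)
    show "\<exists>M. \<forall>m\<ge>M. \<forall>k\<ge>M. dist (l2_seq (X m) n) (l2_seq (X k) n) < e"
    proof (intro exI allI impI)
      fix m k assume "N \<le> m" "N \<le> k"
      then have "norm (X m - X k) < e" using N by auto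
      moreover have "\<bar>l2_seq (X m - X k) n\<bar> \<le> norm (X m - X k)" by (rule l2_coord_le)
      ultimately show "dist (l2_seq (X m) n) (l2_seq (X k) n) < e"
        by (simp add: dist_real_def l2_seq_minus)
    qed
  qed
  then have cv: "convergent (\<lambda>k. l2_seq (X k) n)" for n
    by (simp add: Cauchy_convergent_iff)
  define l where "l n = lim (\<lambda>k. l2_seq (X k) n)" for n
  have l: "(\<lambda>k. l2_seq (X k) n) \<longlonglongrightarrow> l n" for n
    unfolding l_def using cv[of n] by (simp add: convergent_LIMSEQ_iff)
  have key: "\<exists>N. \<forall>k\<ge>N. summable (\<lambda>n. (l2_seq (X k) n - l n)^2) \<and>
                 (\<Sum>n. (l2_seq (X k) n - l n)^2) \<le> e^2" if e: "0 < e" for e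
  proof -
    obtain N where N: "\<forall>m\<ge>N. \<forall>k\<ge>N. norm (X m - X k) < e"
      using C e by (auto simp: Cauchy_iff)
    show ?thesis
    proof (intro exI allI impI)
      fix k assume k: "N \<le> k"
      have ps: "(\<Sum>n<M. (l2_seq (X k) n - l n)^2) \<le> e^2" for M
      proof (rule LIMSEQ_le_const2)
        show "(\<lambda>m. \<Sum>n<M. (l2_seq (X k) n - l2_seq (X m) n)^2) \<longlonglongrightarrow> (\<Sum>n<M. (l2_seq (X k) n - l n)^2)"
          by (intro tendsto_intros l)
        show "\<exists>N'. \<forall>m\<ge>N'. (\<Sum>n<M. (l2_seq (X k) n - l2_seq (X m) n)^2) \<le> e^2"
        proof (intro exI allI impI)
          fix m assume m: "N \<le> m"
          have "(\<Sum>n<M. (l2_seq (X k) n - l2_seq (X m) n)^2) = (\<Sum>n<M. (l2_seq (X k - X m) n)^2)"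
            by (simp add: l2_seq_minus)
          also have "\<dots> \<le> (\<Sum>n. (l2_seq (X k - X m) n)^2)" by (rule l2_sum_le_suminf) simp
          also have "\<dots> = (norm (X k - X m))^2" unfolding norm_l2_eq
            by (simp add: suminf_nonneg l2_summable)
          also have "\<dots> \<le> e^2"
          proof (rule power_mono)
            show "norm (X k - X m) \<le> e" using N k m by (meson less_imp_le)
          qed simp
          finally show "(\<Sum>n<M. (l2_seq (X k) n - l2_seq (X m) n)^2) \<le> e^2" .
        qed
      qed
      have s: "summable (\<lambda>n. (l2_seq (X k) n - l n)^2)"
        by (rule summableI_nonneg_bounded[OF _ ps]) simp
      show "summable (\<lambda>n. (l2_seq (X k) n - l n)^2) \<and> (\<Sum>n. (l2_seq (X k) n - l n)^2) \<le> e^2"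
        using s ps by (auto intro: suminf_le_const)
    qed
  qed
  then obtain N1 where "\<forall>k\<ge>N1. summable (\<lambda>n. (l2_seq (X k) n - l n)^2)"
    using key[of 1] by auto
  then have sd: "summable (\<lambda>n. (l2_seq (X N1) n - l n)^2)" by simp
  have "summable (\<lambda>n. (l2_seq (X N1) n + - (l2_seq (X N1) n - l n))^2)"
  proof (intro summable_sq_add l2_summable)
    have "(\<lambda>n. (- (l2_seq (X N1) n - l n))^2) = (\<lambda>n. (l2_seq (X N1) n - l n)^2)"
      by (simp add: power2_eq_square algebra_simps)
    then show "summable (\<lambda>n. (- (l2_seq (X N1) n - l n))^2)" using sd by simp
  qed
  then have sl: "summable (\<lambda>n. (l n)^2)" by simp
  define L where "L = Abs_l2 l"
  have Ll: "l2_seq L = l" unfolding L_def using sl by (simp add: Abs_l2_inverse)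
  have "X \<longlonglongrightarrow> L"
  proof (rule LIMSEQ_I)
    fix r :: real assume r: "0 < r"
    then obtain N where N: "\<forall>k\<ge>N. summable (\<lambda>n. (l2_seq (X k) n - l n)^2) \<and>
                 (\<Sum>n. (l2_seq (X k) n - l n)^2) \<le> (r/2)^2"
      using key[of "r/2"] by auto
    show "\<exists>no. \<forall>k\<ge>no. norm (X k - L) < r"
    proof (intro exI allI impI)
      fix k assume "N \<le> k"
      then have "(\<Sum>n. (l2_seq (X k) n - l n)^2) \<le> (r/2)^2" using N by auto
      then have "norm (X k - L) \<le> sqrt ((r/2)^2)"
        unfolding norm_l2_eq l2_seq_minus Ll by (rule real_sqrt_le_mono)
      also have "\<dots> < r" using r by simp
      finally show "norm (X k - L) < r" .
    qed
  qed
  then show "convergent X" by (auto simp: convergent_def)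
qed

lift_definition l2_unit :: "nat \<Rightarrow> l2" is "\<lambda>n m. if m = n then 1 else (0::real)"
  by (rule summable_finite[of "{_}"]) auto


text \<open>Functions of arity n are represented as functions on nat lists; only their
  values on lists of length n matter.\<close>

fun prec :: "(nat list \<Rightarrow> nat) \<Rightarrow> (nat list \<Rightarrow> nat) \<Rightarrow> nat list \<Rightarrow> nat" where
  "prec g h [] = g []"
| "prec g h (0 # xs) = g xs"
| "prec g h (Suc k # xs) = h (k # prec g h (k # xs) # xs)"

inductive total_rec :: "nat \<Rightarrow> (nat list \<Rightarrow> nat) \<Rightarrow> bool" where
  rec_zero: "total_rec n (\<lambda>xs. 0)"
| rec_succ: "total_rec 1 (\<lambda>xs. Suc (hd xs))"
| rec_proj: "i < n \<Longrightarrow> total_rec n (\<lambda>xs. xs ! i)"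
| rec_comp: "total_rec (length fs) g \<Longrightarrow> (\<forall>f \<in> set fs. total_rec n f)
     \<Longrightarrow> total_rec n (\<lambda>xs. g (map (\<lambda>f. f xs) fs))"
| rec_prim: "total_rec n g \<Longrightarrow> total_rec (Suc (Suc n)) h \<Longrightarrow> total_rec (Suc n) (prec g h)"
| rec_mu: "total_rec (Suc n) f \<Longrightarrow> (\<forall>xs. length xs = n \<longrightarrow> (\<exists>y. f (y # xs) = 0))
     \<Longrightarrow> total_rec n (\<lambda>xs. LEAST y. f (y # xs) = 0)"

definition computable_fun :: "nat \<Rightarrow> (nat list \<Rightarrow> nat) \<Rightarrow> bool" where
  "computable_fun n f \<longleftrightarrow> (\<exists>g. total_rec n g \<and> (\<forall>xs. length xs = n \<longrightarrow> g xs = f xs))"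

type_synonym baire = "nat \<Rightarrow> nat"

definition prefix_code :: "baire \<Rightarrow> nat \<Rightarrow> nat" where
  "prefix_code p k = list_encode (map p [0..<k])"

text \<open>Standard representation of continuous partial functions on Baire space:
  the word function coded by M (finite input prefixes to finite output words) determines
  the partial function eta M, defined at p iff the outputs on the prefixes of p are
  mutually consistent and of unbounded length.\<close>
definition eta :: "baire \<Rightarrow> baire \<Rightarrow> baire option" where
  "eta M p =
    (let out = (\<lambda>k. list_decode (M (prefix_code p k))) in
     if (\<forall>n. \<exists>k. n < length (out k)) \<and>
        (\<forall>k k' i. i < length (out k) \<and> i < length (out k') \<longrightarrow> out k ! i = out k' ! i)
     then Some (\<lambda>i. out (LEAST k. i < length (out k)) ! i)
     else None)"

definition computable_pf :: "(baire \<Rightarrow> baire option) \<Rightarrow> bool" where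
  "computable_pf F \<longleftrightarrow>
     (\<exists>M. computable_fun 1 (\<lambda>xs. M (hd xs)) \<and> (\<forall>p q. F p = Some q \<longrightarrow> eta M p = Some q))"

definition pair_baire :: "baire \<Rightarrow> baire \<Rightarrow> baire" where
  "pair_baire p q = (\<lambda>n. if even n then p (n div 2) else q (n div 2))"

text \<open>A representation of a space with points of type 'a: a partial map from Baire space
  (the represented space is its range). Partial multi-valued maps are maps
  f :: 'a \<Rightarrow> 'b set, with domain {x. f x \<noteq> {}}.\<close>
type_synonym 'a rep = "baire \<Rightarrow> 'a option"

definition realizer :: "'a rep \<Rightarrow> 'b rep \<Rightarrow> ('a \<Rightarrow> 'b set) \<Rightarrow> (baire \<Rightarrow> baire option) \<Rightarrow> bool" where
  "realizer \<delta>X \<delta>Y f F \<longleftrightarrow>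
     (\<forall>p x. \<delta>X p = Some x \<and> f x \<noteq> {} \<longrightarrow> (\<exists>q y. F p = Some q \<and> \<delta>Y q = Some y \<and> y \<in> f x))"

definition weihrauch_le ::
  "'a rep \<Rightarrow> 'b rep \<Rightarrow> ('a \<Rightarrow> 'b set) \<Rightarrow> 'c rep \<Rightarrow> 'd rep \<Rightarrow> ('c \<Rightarrow> 'd set) \<Rightarrow> bool" where
  "weihrauch_le \<delta>X \<delta>Y f \<delta>U \<delta>V g \<longleftrightarrow>
     (\<exists>H K. computable_pf H \<and> computable_pf K \<and>
        (\<forall>G. realizer \<delta>U \<delta>V g G \<longrightarrow>
              realizer \<delta>X \<delta>Y f
                (\<lambda>p. case K p of None \<Rightarrow> None
                       | Some k \<Rightarrow> (case G k of None \<Rightarrow> None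
                                      | Some r \<Rightarrow> H (pair_baire p r)))))"

definition weihrauch_eq ::
  "'a rep \<Rightarrow> 'b rep \<Rightarrow> ('a \<Rightarrow> 'b set) \<Rightarrow> 'c rep \<Rightarrow> 'd rep \<Rightarrow> ('c \<Rightarrow> 'd set) \<Rightarrow> bool" where
  "weihrauch_eq \<delta>X \<delta>Y f \<delta>U \<delta>V g \<longleftrightarrow>
     weihrauch_le \<delta>X \<delta>Y f \<delta>U \<delta>V g \<and> weihrauch_le \<delta>U \<delta>V g \<delta>X \<delta>Y f"

definition rep_nat :: "nat rep" where
  "rep_nat p = Some (p 0)"

definition rep_Aminus_nat :: "nat set rep" where
  "rep_Aminus_nat p = Some {n. Suc n \<notin> range p}"

definition C_N :: "nat set \<Rightarrow> nat set" where
  "C_N A = A"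

definition real_of_code :: "nat \<Rightarrow> real" where
  "real_of_code n = (case prod_decode n of (a, b) \<Rightarrow> of_int (int_decode a) / of_nat (Suc b))"

definition computable_real_fun2 :: "(nat \<Rightarrow> nat \<Rightarrow> real) \<Rightarrow> bool" where
  "computable_real_fun2 r \<longleftrightarrow>
     (\<exists>f. computable_fun 3 f \<and>
          (\<forall>i j k. \<bar>real_of_code (f [i, j, k]) - r i j\<bar> \<le> (1/2)^k))"

text \<open>A computable metric space: a dense sequence on which the metric is computable
  (completeness is supplied by the type class where needed).\<close>
definition computable_metric_space :: "(nat \<Rightarrow> 'a::metric_space) \<Rightarrow> bool" where
  "computable_metric_space \<alpha> \<longleftrightarrow>
     closure (range \<alpha>) = UNIV \<and> computable_real_fun2 (\<lambda>i j. dist (\<alpha> i) (\<alpha> j))"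

definition dense_seq :: "(nat \<Rightarrow> 'a::real_vector) \<Rightarrow> nat \<Rightarrow> 'a" where
  "dense_seq e n =
     (let qs = list_decode n in \<Sum>i<length qs. real_of_code (qs ! i) *\<^sub>R e i)"

definition computable_banach :: "(nat \<Rightarrow> 'a::banach) \<Rightarrow> bool" where
  "computable_banach e \<longleftrightarrow>
     closure (span (range e)) = UNIV \<and> computable_metric_space (dense_seq e)"

definition cauchy_rep :: "(nat \<Rightarrow> 'a::metric_space) \<Rightarrow> 'a rep" where
  "cauchy_rep \<alpha> p =
     (if \<exists>x. \<forall>i. dist (\<alpha> (p i)) x \<le> (1/2)^i
      then Some (THE x. \<forall>i. dist (\<alpha> (p i)) x \<le> (1/2)^i) else None)"

definition prod_seq :: "(nat \<Rightarrow> 'a) \<Rightarrow> (nat \<Rightarrow> 'b) \<Rightarrow> nat \<Rightarrow> 'a \<times> 'b" where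
  "prod_seq \<alpha> \<beta> n = (case prod_decode n of (i, j) \<Rightarrow> (\<alpha> i, \<beta> j))"

definition rat_ball :: "(nat \<Rightarrow> 'a::metric_space) \<Rightarrow> nat \<Rightarrow> 'a set" where
  "rat_ball \<alpha> n = (case prod_decode n of (c, r) \<Rightarrow> ball (\<alpha> c) (real_of_code r))"

definition rep_Aplus :: "(nat \<Rightarrow> 'a::metric_space) \<Rightarrow> 'a set rep" where
  "rep_Aplus \<alpha> p =
     (if \<exists>A. closed A \<and> {n. Suc n \<in> range p} = {n. rat_ball \<alpha> n \<inter> A \<noteq> {}}
      then Some (THE A. closed A \<and> {n. Suc n \<in> range p} = {n. rat_ball \<alpha> n \<inter> A \<noteq> {}})
      else None)"

definition rep_fun :: "'a rep \<Rightarrow> 'b rep \<Rightarrow> ('a::topological_space \<Rightarrow> 'b::topological_space) rep" where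
  "rep_fun \<delta>X \<delta>Y p =
     (if \<exists>T. continuous_on UNIV T \<and> realizer \<delta>X \<delta>Y (\<lambda>x. {T x}) (eta p)
      then Some (THE T. continuous_on UNIV T \<and> realizer \<delta>X \<delta>Y (\<lambda>x. {T x}) (eta p))
      else None)"

definition CGT :: "('a::real_normed_vector \<times> 'b::real_normed_vector) set \<Rightarrow> ('a \<Rightarrow> 'b) set" where
  "CGT A = {T. bounded_linear T \<and> A = {(x, T x) | x. True}}"

definition rep_graph :: "(nat \<Rightarrow> 'a::banach) \<Rightarrow> (nat \<Rightarrow> 'b::banach) \<Rightarrow> ('a \<times> 'b) set rep" where
  "rep_graph e e' = rep_Aplus (prod_seq (dense_seq e) (dense_seq e'))"

definition rep_ops :: "(nat \<Rightarrow> 'a::banach) \<Rightarrow> (nat \<Rightarrow> 'b::banach) \<Rightarrow> ('a \<Rightarrow> 'b) rep" where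
  "rep_ops e e' = rep_fun (cauchy_rep (dense_seq e)) (cauchy_rep (dense_seq e'))"

end

theory Submission
  imports Defs
begin

text \<open>
  For \<open>CGT \<le> C_N\<close>: from an enumeration of the rational balls meeting the graph of \<open>T\<close> one can
  recognise that a number \<open>M\<close> is not a bound of \<open>T\<close>, so \<open>C_N\<close> finds a bound. Given a bound \<open>M\<close>, any
  listed ball whose centre \<open>(c, d)\<close> has \<open>c\<close> close to \<open>x\<close> and whose radius is small has \<open>d\<close> provably
  close to \<open>T x\<close>.

  For \<open>C_N \<le> CGT\<close> on \<open>l2\<close>: let \<open>x_n\<close> be the least number not excluded by the first \<open>n\<close> entries of
  the given enumeration. This sequence changes only finitely often, and its limit is a solution. The
  diagonal operator with weights \<open>n\<close> where \<open>x_n \<noteq> x_(n+1)\<close> and \<open>0\<close> elsewhere is bounded, and its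
  graph can be enumerated. A name of the operator as a continuous function reveals a neighbourhood of
  \<open>0\<close> on which it is bounded, hence a bound of its norm, hence a stage after which \<open>x_n\<close> is constant.
\<close>

section \<open>Total computable functions of one argument\<close>

text \<open>Exceeding M, \<open>norm (T x) > M * norm x\<close>, is an open condition on a point of
  the graph, so a small enough listed ball witnesses it. The natural bounds of \<open>T\<close> thus
  form a nonempty set with enumerable complement. The graph alone carries no modulus of continuity;
  a bound supplies it.

  Conversely, a change at n gets weight n so that it forces the norm up to n: a bound on the norm
  then bounds the time of the last change. The graph must be listed without knowing that time. This
  works because a finitely supported rational vector involves only finitely many weights, and such
  vectors suffice by density and continuity. The bound comes from the first output of a name of the
  operator: if it is fixed after k zeros of the name of 0, every vector of norm at most
  \<open>(1/2) ^ k\<close> shares it, which gives \<open>2 ^ Suc k\<close>.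

  Names of functions are total word functions, whereas the algorithms search names without a known
  end. Such searches are therefore cut off at the length of the given word.\<close>

lemma computable_fun_cong:
  assumes "computable_fun n f" "\<And>xs. length xs = n \<Longrightarrow> f xs = g xs"
  shows "computable_fun n g"
  using assms unfolding computable_fun_def by metis

lemma computable_fun_comp:
  assumes "computable_fun (length fs) g" "\<And>f. f \<in> set fs \<Longrightarrow> computable_fun n f"
  shows "computable_fun n (\<lambda>xs. g (map (\<lambda>f. f xs) fs))"
proof -
  obtain g' where g': "total_rec (length fs) g'" "\<And>xs. length xs = length fs \<Longrightarrow> g' xs = g xs"
    using assms(1) unfolding computable_fun_def by auto
  obtain h where h: "\<And>f. f \<in> set fs \<Longrightarrow> total_rec n (h f)"
      "\<And>f xs. f \<in> set fs \<Longrightarrow> length xs = n \<Longrightarrow> h f xs = f xs"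
    using assms(2) unfolding computable_fun_def by metis
  have "total_rec n (\<lambda>xs. g' (map (\<lambda>f. f xs) (map h fs)))"
    by (rule rec_comp) (use g' h in auto)
  moreover have "g' (map (\<lambda>f. f xs) (map h fs)) = g (map (\<lambda>f. f xs) fs)" if "length xs = n" for xs
  proof -
    have "map (\<lambda>f. f xs) (map h fs) = map (\<lambda>f. f xs) fs" using h that by simp
    then show ?thesis using g'(2)[of "map (\<lambda>f. f xs) fs"] by (simp only: length_map)
  qed
  ultimately show ?thesis unfolding computable_fun_def by blast
qed

lemma computable_fun_nth: "i < n \<Longrightarrow> computable_fun n (\<lambda>xs. xs ! i)"
  unfolding computable_fun_def using rec_proj by blast

lemma computable_fun_Suc: "computable_fun n f \<Longrightarrow> computable_fun n (\<lambda>xs. Suc (f xs))"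
proof -
  assume f: "computable_fun n f"
  have "computable_fun (length [f]) (\<lambda>xs. Suc (hd xs))"
    unfolding computable_fun_def using rec_succ by auto
  from computable_fun_comp[OF this, of n] f show ?thesis by simp
qed

lemma computable_fun_const: "computable_fun n (\<lambda>xs. c)"
proof (induction c)
  case 0
  show ?case unfolding computable_fun_def using rec_zero by blast
qed (rule computable_fun_Suc)

lemma computable_fun_rec_nat:
  assumes "computable_fun n a" "computable_fun (Suc (Suc n)) h"
  shows "computable_fun (Suc n) (\<lambda>xs. rec_nat (a (tl xs)) (\<lambda>k y. h (k # y # tl xs)) (hd xs))"
proof -
  obtain a' h' where a': "total_rec n a'" "\<And>xs. length xs = n \<Longrightarrow> a' xs = a xs"
    and h': "total_rec (Suc (Suc n)) h'" "\<And>xs. length xs = Suc (Suc n) \<Longrightarrow> h' xs = h xs"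
    using assms unfolding computable_fun_def by metis
  have "prec a' h' (m # xs) = rec_nat (a xs) (\<lambda>k y. h (k # y # xs)) m" if "length xs = n" for m xs
    using that by (induction m) (auto simp: a' h')
  then have "prec a' h' xs = rec_nat (a (tl xs)) (\<lambda>k y. h (k # y # tl xs)) (hd xs)"
    if "length xs = Suc n" for xs using that by (cases xs) auto
  then show ?thesis unfolding computable_fun_def using rec_prim[OF a'(1) h'(1)] by blast
qed

lemma computable_fun_Least:
  assumes "computable_fun (Suc n) f" "\<And>xs. length xs = n \<Longrightarrow> \<exists>y. f (y # xs) = 0"
  shows "computable_fun n (\<lambda>xs. LEAST y. f (y # xs) = 0)"
proof -
  obtain f' where f': "total_rec (Suc n) f'" "\<And>xs. length xs = Suc n \<Longrightarrow> f' xs = f xs"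
    using assms unfolding computable_fun_def by metis
  have "total_rec n (\<lambda>xs. LEAST y. f' (y # xs) = 0)"
    by (rule rec_mu) (use f' assms(2) in auto)
  moreover have "(LEAST y. f' (y # xs) = 0) = (LEAST y. f (y # xs) = 0)" if "length xs = n" for xs
    using f'(2) that by simp
  ultimately show ?thesis unfolding computable_fun_def by blast
qed

text \<open>Restricting to one argument, with several arguments coded into it by pairing, gives
  closure rules that apply by plain \<open>intro\<close>, without argument lists.\<close>

definition recfun :: "(nat \<Rightarrow> nat) \<Rightarrow> bool"
  where "recfun f \<longleftrightarrow> computable_fun 1 (\<lambda>xs. f (hd xs))"

lemma recfun_computable_fun:
  assumes "recfun f" "computable_fun n g"
  shows "computable_fun n (\<lambda>xs. f (g xs))"
  using computable_fun_comp[of "[g]" "\<lambda>xs. f (hd xs)" n] assms unfolding recfun_def by simp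

lemma recfun_id: "recfun (\<lambda>x. x)"
  unfolding recfun_def by (rule computable_fun_cong[OF computable_fun_nth[of 0]]) (auto simp: length_Suc_conv)

lemma recfun_const: "recfun (\<lambda>x. c)"
  unfolding recfun_def by (rule computable_fun_const)

lemma recfun_comp:
  assumes "recfun f" "recfun g"
  shows "recfun (\<lambda>x. f (g x))"
  using recfun_computable_fun[OF assms(1)] assms(2) unfolding recfun_def by blast

lemma recfun_binary:
  assumes "computable_fun 2 (\<lambda>xs. h (xs ! 0) (xs ! 1))" "recfun f" "recfun g"
  shows "recfun (\<lambda>x. h (f x) (g x))"
  using computable_fun_comp[of "[\<lambda>xs. f (hd xs), \<lambda>xs. g (hd xs)]" "\<lambda>xs. h (xs ! 0) (xs ! 1)" 1] assms
  unfolding recfun_def by (auto simp: numeral_2_eq_2)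

lemma computable_fun_binary:
  assumes "computable_fun 2 (\<lambda>xs. h (xs ! 0) (xs ! 1))" "computable_fun n f" "computable_fun n g"
  shows "computable_fun n (\<lambda>x. h (f x) (g x))"
  using computable_fun_comp[of "[f, g]" "\<lambda>xs. h (xs ! 0) (xs ! 1)" n] assms
  by (auto simp: numeral_2_eq_2)

lemma recfun_Suc: "recfun f \<Longrightarrow> recfun (\<lambda>x. Suc (f x))"
  unfolding recfun_def by (rule computable_fun_Suc)

lemma computable_fun_add: "computable_fun 2 (\<lambda>xs. xs ! 0 + xs ! 1)"
proof -
  have "computable_fun (Suc 1) (\<lambda>xs. rec_nat ((\<lambda>ys. ys ! 0) (tl xs)) (\<lambda>k y. (\<lambda>ys. Suc (ys ! 1)) (k # y # tl xs)) (hd xs))"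
    by (intro computable_fun_rec_nat computable_fun_nth computable_fun_Suc) auto
  then show ?thesis
    unfolding Suc_1
  proof (elim computable_fun_cong)
    fix xs :: "nat list" assume "length xs = 2"
    then obtain a b where xs: "xs = [a, b]" by (auto simp: length_Suc_conv numeral_2_eq_2)
    have "rec_nat b (\<lambda>k. Suc) a = a + b" by (induction a) auto
    then show "rec_nat ((\<lambda>ys. ys ! 0) (tl xs)) (\<lambda>k y. (\<lambda>ys. Suc (ys ! 1)) (k # y # tl xs)) (hd xs) = xs ! 0 + xs ! 1"
      by (simp add: xs)
  qed
qed

lemma computable_fun_mult: "computable_fun 2 (\<lambda>xs. xs ! 0 * xs ! 1)"
proof -
  have "computable_fun (Suc 1) (\<lambda>xs. rec_nat ((\<lambda>ys. 0) (tl xs)) (\<lambda>k y. (\<lambda>ys. ys ! 1 + ys ! 2) (k # y # tl xs)) (hd xs))"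
    by (intro computable_fun_rec_nat computable_fun_nth computable_fun_const computable_fun_binary[OF computable_fun_add]) auto
  then show ?thesis
    unfolding Suc_1
  proof (elim computable_fun_cong)
    fix xs :: "nat list" assume "length xs = 2"
    then obtain a b where xs: "xs = [a, b]" by (auto simp: length_Suc_conv numeral_2_eq_2)
    have "rec_nat 0 (\<lambda>k y. y + b) a = a * b" by (induction a) auto
    then show "rec_nat ((\<lambda>ys. 0) (tl xs)) (\<lambda>k y. (\<lambda>ys. ys ! 1 + ys ! 2) (k # y # tl xs)) (hd xs) = xs ! 0 * xs ! 1"
      by (simp add: xs numeral_2_eq_2)
  qed
qed

lemma recfun_pred: "recfun (\<lambda>x. x - 1)"
proof -
  have "computable_fun (Suc 0) (\<lambda>xs. rec_nat ((\<lambda>ys. 0) (tl xs)) (\<lambda>k y. (\<lambda>ys. ys ! 0) (k # y # tl xs)) (hd xs))"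
    by (intro computable_fun_rec_nat computable_fun_nth computable_fun_const) auto
  then show ?thesis unfolding recfun_def One_nat_def
  proof (elim computable_fun_cong)
    fix xs :: "nat list"
    show "rec_nat ((\<lambda>ys. 0) (tl xs)) (\<lambda>k y. (\<lambda>ys. ys ! 0) (k # y # tl xs)) (hd xs) = hd xs - Suc 0"
      by (cases "hd xs") auto
  qed
qed

lemma computable_fun_diff: "computable_fun 2 (\<lambda>xs. xs ! 0 - xs ! 1)"
proof -
  have "computable_fun (Suc 1) (\<lambda>xs. rec_nat ((\<lambda>ys. ys ! 0) (tl xs)) (\<lambda>k y. (\<lambda>ys. ys ! 1 - 1) (k # y # tl xs)) (hd xs))"
    by (intro computable_fun_rec_nat computable_fun_nth recfun_computable_fun[OF recfun_pred]) auto
  \<comment> \<open>The recursion runs over the first argument, which has to be the subtrahend; the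
    arguments are exchanged at the end.\<close>
  then have *: "computable_fun 2 (\<lambda>xs. (\<lambda>a b. b - a) (xs ! 0) (xs ! 1))"
    unfolding Suc_1
  proof (elim computable_fun_cong)
    fix xs :: "nat list" assume "length xs = 2"
    then obtain a b where xs: "xs = [a, b]" by (auto simp: length_Suc_conv numeral_2_eq_2)
    have "rec_nat b (\<lambda>k y. y - Suc 0) a = b - a" by (induction a) auto
    then show "rec_nat ((\<lambda>ys. ys ! 0) (tl xs)) (\<lambda>k y. (\<lambda>ys. ys ! 1 - 1) (k # y # tl xs)) (hd xs) = (\<lambda>a b. b - a) (xs ! 0) (xs ! 1)"
      by (simp add: xs)
  qed
  show ?thesis
    by (rule computable_fun_binary[OF *, of _ "\<lambda>xs. xs ! 1" "\<lambda>xs. xs ! 0"]) (auto intro: computable_fun_nth)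
qed

lemmas recfun_add = recfun_binary[OF computable_fun_add]
  and recfun_mult = recfun_binary[OF computable_fun_mult]
  and recfun_diff = recfun_binary[OF computable_fun_diff]

section \<open>Cantor pairing and its inverse\<close>

lemma recfun_triangle: "recfun f \<Longrightarrow> recfun (\<lambda>x. triangle (f x))"
proof -
  have "computable_fun (Suc 0) (\<lambda>xs. rec_nat ((\<lambda>ys. 0) (tl xs)) (\<lambda>k y. (\<lambda>ys. ys ! 1 + Suc (ys ! 0)) (k # y # tl xs)) (hd xs))"
    by (intro computable_fun_rec_nat computable_fun_nth computable_fun_const computable_fun_Suc computable_fun_binary[OF computable_fun_add]) auto
  then have "recfun triangle" unfolding recfun_def One_nat_def
  proof (elim computable_fun_cong)
    fix xs :: "nat list"
    have "rec_nat 0 (\<lambda>k y. y + Suc k) n = triangle n" for n by (induction n) auto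
    then show "rec_nat ((\<lambda>ys. 0) (tl xs)) (\<lambda>k y. (\<lambda>ys. ys ! Suc 0 + Suc (ys ! 0)) (k # y # tl xs)) (hd xs) = triangle (hd xs)"
      by simp
  qed
  then show "recfun f \<Longrightarrow> ?thesis" by (rule recfun_comp)
qed

lemma computable_fun_prod_encode: "computable_fun 2 (\<lambda>xs. prod_encode (xs ! 0, xs ! 1))"
proof -
  have "recfun triangle" using recfun_triangle[OF recfun_id] .
  then show ?thesis unfolding prod_encode_def
    by (auto intro!: computable_fun_binary[OF computable_fun_add] computable_fun_nth recfun_computable_fun[of triangle])
qed

lemmas recfun_prod_encode = recfun_binary[OF computable_fun_prod_encode]

text \<open>The pairs with sum s occupy the codes from \<open>triangle s\<close> up to, but
  excluding, \<open>triangle (Suc s)\<close>. So the sum is found by a search, and the components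
  follow by subtraction. A truncated difference equal to 0 expresses
  \<open>z < triangle (Suc s)\<close>.\<close>

lemma prod_decode_Least:
  defines "s \<equiv> \<lambda>z. LEAST s. Suc z - triangle (Suc s) = 0"
  shows "prod_decode z = (z - triangle (s z), s z - (z - triangle (s z)))"
proof -
  obtain a b where ab: "prod_decode z = (a, b)" by (cases "prod_decode z")
  then have z: "z = triangle (a + b) + a"
    using prod_decode_inverse[of z] by (simp add: prod_encode_def)
  have mono: "triangle i \<le> triangle j" if "i \<le> j" for i j
    using that by (induction rule: dec_induct) auto
  have "s z = a + b" unfolding s_def
  proof (rule Least_equality)
    show "Suc z - triangle (Suc (a + b)) = 0" by (simp add: z)
    fix y assume "Suc z - triangle (Suc y) = 0"
    then have "triangle (a + b) < triangle (Suc y)" using z by linarith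
    then show "a + b \<le> y" using mono[of "Suc y" "a + b"] by linarith
  qed
  then show ?thesis using z ab by simp
qed

lemma recfun_prod_decode: "recfun (\<lambda>z. LEAST s. Suc z - triangle (Suc s) = 0)"
proof -
  have "computable_fun (Suc 1) (\<lambda>xs. Suc (xs ! 1) - triangle (Suc (xs ! 0)))"
    by (intro computable_fun_binary[OF computable_fun_diff] computable_fun_Suc computable_fun_nth
      recfun_computable_fun[OF recfun_triangle, OF recfun_id]) auto
  then have "computable_fun 1 (\<lambda>xs. LEAST y. Suc ((y # xs) ! 1) - triangle (Suc ((y # xs) ! 0)) = 0)"
  proof (rule computable_fun_Least)
    fix xs :: "nat list"
    have "n \<le> triangle n" for n by (induction n) auto
    from this[of "xs ! 0"] have "Suc (xs ! 0) \<le> triangle (Suc (xs ! 0))" by simp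
    then show "\<exists>y. Suc ((y # xs) ! 1) - triangle (Suc ((y # xs) ! 0)) = 0"
      by (intro exI[of _ "xs ! 0"]) (simp del: triangle_Suc)
  qed
  then show ?thesis unfolding recfun_def by (elim computable_fun_cong) (auto simp: length_Suc_conv)
qed

abbreviation pfst :: "nat \<Rightarrow> nat" where "pfst z \<equiv> fst (prod_decode z)"
abbreviation psnd :: "nat \<Rightarrow> nat" where "psnd z \<equiv> snd (prod_decode z)"

lemma recfun_pfst: "recfun f \<Longrightarrow> recfun (\<lambda>x. pfst (f x))"
proof -
  have "recfun pfst" unfolding prod_decode_Least fst_conv
    by (intro recfun_diff recfun_triangle recfun_id recfun_prod_decode)
  then show "recfun f \<Longrightarrow> ?thesis" by (rule recfun_comp)
qed

lemma recfun_psnd: "recfun f \<Longrightarrow> recfun (\<lambda>x. psnd (f x))"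
proof -
  have "recfun psnd" unfolding prod_decode_Least snd_conv
    by (intro recfun_diff recfun_triangle recfun_id recfun_prod_decode)
  then show "recfun f \<Longrightarrow> ?thesis" by (rule recfun_comp)
qed

lemmas recfun_intros = recfun_id recfun_const recfun_Suc recfun_add recfun_mult recfun_diff
  recfun_prod_encode recfun_pfst recfun_psnd

text \<open>The hypothesis on \<open>h\<close> ranges over codes z of triples
  \<open>(x, (k, y))\<close>, because \<open>recfun\<close> knows one argument only. Later rules
  with binary parameters use the same device.\<close>

lemma recfun_rec_nat:
  assumes "recfun a" "recfun (\<lambda>z. h (pfst z) (pfst (psnd z)) (psnd (psnd z)))" "recfun m"
  shows "recfun (\<lambda>x. rec_nat (a x) (\<lambda>k y. h x k y) (m x))"
proof -
  have h: "computable_fun (Suc (Suc 1)) (\<lambda>ys. h (ys ! 2) (ys ! 0) (ys ! 1))"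
    using recfun_computable_fun[OF assms(2),
      of 3 "\<lambda>ys. prod_encode (ys ! 2, prod_encode (ys ! 0, ys ! 1))"]
    by (simp add: numeral_3_eq_3 computable_fun_binary[OF computable_fun_prod_encode] computable_fun_nth)
  have a: "computable_fun 1 (\<lambda>xs. a (hd xs))" using assms(1) by (simp add: recfun_def)
  from computable_fun_rec_nat[OF a h]
  have "computable_fun (Suc 1) (\<lambda>xs. rec_nat (a (hd (tl xs))) (\<lambda>k y. h (hd (tl xs)) k y) (hd xs))"
    by (elim computable_fun_cong) (auto simp: length_Suc_conv)
  then have *: "computable_fun 2 (\<lambda>xs. (\<lambda>m x. rec_nat (a x) (\<lambda>k y. h x k y) m) (xs ! 0) (xs ! 1))"
    unfolding One_nat_def numeral_2_eq_2[symmetric]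
    by (elim computable_fun_cong) (auto simp: length_Suc_conv numeral_2_eq_2)
  show ?thesis by (rule recfun_binary[OF * assms(3) recfun_id])
qed

section \<open>Decidable predicates, search and bounded quantifiers\<close>

definition decidable :: "(nat \<Rightarrow> bool) \<Rightarrow> bool"
  where "decidable P \<longleftrightarrow> recfun (\<lambda>x. of_bool (P x))"

lemma recfun_of_bool: "decidable P \<Longrightarrow> recfun (\<lambda>x. of_bool (P x))"
  by (simp add: decidable_def)

lemma decidable_comp: "decidable P \<Longrightarrow> recfun f \<Longrightarrow> decidable (\<lambda>x. P (f x))"
  unfolding decidable_def by (rule recfun_comp)

lemma decidable_not: "decidable P \<Longrightarrow> decidable (\<lambda>x. \<not> P x)"
  unfolding decidable_def of_bool_not_iff
proof -
  assume "recfun (\<lambda>x. of_bool (P x))"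
  then have "recfun (\<lambda>x. 1 - of_bool (P x))" by (intro recfun_intros)
  moreover have "(1 - of_bool b :: nat) = of_bool (\<not> b)" for b by simp
  ultimately show "recfun (\<lambda>x. of_bool (\<not> P x))" by simp
qed

lemma decidable_and: "decidable P \<Longrightarrow> decidable Q \<Longrightarrow> decidable (\<lambda>x. P x \<and> Q x)"
  unfolding decidable_def of_bool_conj by (rule recfun_mult)

lemma decidable_or: "decidable P \<Longrightarrow> decidable Q \<Longrightarrow> decidable (\<lambda>x. P x \<or> Q x)"
  using decidable_not[OF decidable_and[OF decidable_not decidable_not], of P Q] by simp

lemma decidable_less: "recfun f \<Longrightarrow> recfun g \<Longrightarrow> decidable (\<lambda>x. f x < g x)"
proof -
  assume "recfun f" "recfun g"
  then have "recfun (\<lambda>x. 1 - (Suc (f x) - g x))" by (intro recfun_intros)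
  moreover have "1 - (Suc a - b) = of_bool (a < b)" for a b by auto
  ultimately show ?thesis by (simp add: decidable_def)
qed

lemma decidable_le: "recfun f \<Longrightarrow> recfun g \<Longrightarrow> decidable (\<lambda>x. f x \<le> g x)"
  using decidable_not[OF decidable_less, of g f] by (simp add: not_less)

lemma decidable_eq: "recfun f \<Longrightarrow> recfun g \<Longrightarrow> decidable (\<lambda>x. f x = g x)"
  using decidable_and[OF decidable_le decidable_le, of f g g f] by (simp add: order_eq_iff)

lemma recfun_if:
  assumes "decidable P" "recfun f" "recfun g"
  shows "recfun (\<lambda>x. if P x then f x else g x)"
proof -
  have "recfun (\<lambda>x. of_bool (P x) * f x + of_bool (\<not> P x) * g x)"
    using assms by (intro recfun_intros recfun_of_bool decidable_not)
  moreover have "of_bool b * u + of_bool (\<not> b) * v = (if b then u else v)" for b and u v :: nat by simp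
  ultimately show ?thesis by simp
qed

lemma recfun_Least:
  assumes "decidable (\<lambda>z. P (pfst z) (psnd z))" "\<And>x. \<exists>y. P x y"
  shows "recfun (\<lambda>x. LEAST y. P x y)"
proof -
  have "computable_fun (Suc 1) (\<lambda>ys. of_bool (\<not> P (ys ! 1) (ys ! 0)))"
    using recfun_computable_fun[OF decidable_not[OF assms(1), unfolded decidable_def],
      of 2 "\<lambda>ys. prod_encode (ys ! 1, ys ! 0)"]
    by (simp add: numeral_2_eq_2 computable_fun_binary[OF computable_fun_prod_encode] computable_fun_nth)
  then have "computable_fun 1 (\<lambda>xs. LEAST y. of_bool (\<not> P ((y # xs) ! 1) ((y # xs) ! 0)) = (0::nat))"
    by (rule computable_fun_Least) (use assms(2) in auto)
  moreover have "(LEAST y. of_bool (\<not> P ((y # xs) ! 1) ((y # xs) ! 0)) = (0::nat)) = (LEAST y. P (hd xs) y)"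
    if "length xs = 1" for xs
    using that by (cases xs) auto
  ultimately show ?thesis unfolding recfun_def by (rule computable_fun_cong)
qed

text \<open>The disjunct \<open>n x \<le> i\<close> makes the search end in any case; a witness
  exists exactly if it ends before \<open>n x\<close>.\<close>

lemma decidable_Ex_less:
  assumes "decidable (\<lambda>z. P (pfst z) (psnd z))" "recfun n"
  shows "decidable (\<lambda>x. \<exists>i<n x. P x i)"
proof -
  have "recfun (\<lambda>x. LEAST i. P x i \<or> n x \<le> i)"
    by (intro recfun_Least decidable_or decidable_le assms(1) recfun_intros recfun_comp[OF assms(2)]) auto
  from decidable_less[OF this assms(2)] have "decidable (\<lambda>x. (LEAST i. P x i \<or> n x \<le> i) < n x)" .
  moreover have "(LEAST i. P x i \<or> n x \<le> i) < n x \<longleftrightarrow> (\<exists>i<n x. P x i)" for x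
  proof
    assume l: "(LEAST i. P x i \<or> n x \<le> i) < n x"
    have "P x (LEAST i. P x i \<or> n x \<le> i) \<or> n x \<le> (LEAST i. P x i \<or> n x \<le> i)"
      by (rule LeastI[of _ "n x"]) auto
    with l show "\<exists>i<n x. P x i" by auto
  next
    assume "\<exists>i<n x. P x i"
    then obtain i where "i < n x" "P x i" by auto
    then have "(LEAST i. P x i \<or> n x \<le> i) \<le> i" by (intro Least_le) auto
    with \<open>i < n x\<close> show "(LEAST i. P x i \<or> n x \<le> i) < n x" by simp
  qed
  ultimately show ?thesis by simp
qed

lemma decidable_All_less:
  assumes "decidable (\<lambda>z. P (pfst z) (psnd z))" "recfun n"
  shows "decidable (\<lambda>x. \<forall>i<n x. P x i)"
  using decidable_not[OF decidable_Ex_less[OF decidable_not[OF assms(1)] assms(2)]] by simp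

lemma recfun_power: "recfun f \<Longrightarrow> recfun g \<Longrightarrow> recfun (\<lambda>x. f x ^ g x)"
proof -
  assume f: "recfun f" and "recfun g"
  then have "recfun (\<lambda>x. rec_nat 1 (\<lambda>k y. y * f x) (g x))"
    by (intro recfun_rec_nat recfun_intros recfun_comp[OF f])
  moreover have "rec_nat 1 (\<lambda>k y. y * b) n = b ^ n" for b n :: nat by (induction n) auto
  ultimately show ?thesis by simp
qed

lemma recfun_div2: "recfun f \<Longrightarrow> recfun (\<lambda>x. f x div 2)"
proof -
  assume f: "recfun f"
  have "recfun (\<lambda>x. LEAST q. f x < 2 * Suc q)"
  proof (rule recfun_Least)
    show "\<exists>q. f x < 2 * Suc q" for x by (rule exI[of _ "f x"]) simp
  qed (intro decidable_less recfun_intros recfun_comp[OF f])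
  moreover have "(LEAST q. n < 2 * Suc q) = n div 2" for n :: nat
    by (rule Least_equality) auto
  ultimately show ?thesis by simp
qed

lemma decidable_even: "recfun f \<Longrightarrow> decidable (\<lambda>x. even (f x))"
proof -
  assume "recfun f"
  then have "decidable (\<lambda>x. 2 * (f x div 2) = f x)" by (intro decidable_eq recfun_intros recfun_div2)
  moreover have "2 * (n div 2) = n \<longleftrightarrow> even n" for n :: nat by presburger
  ultimately show ?thesis by simp
qed

section \<open>Coded lists, functionals on Baire space, rational arithmetic\<close>

lemma prod_decode_0: "prod_decode 0 = (0, 0)"
  using prod_encode_inverse[of "(0, 0)"] by (simp add: prod_encode_def)

text \<open>A nonempty list is coded by \<open>Suc\<close> of the pair of head and tail code, so
  \<open>psnd (y - 1)\<close> is the tail. The empty list has code 0, which is a fixed point of this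
  step as \<open>prod_decode 0 = (0, 0)\<close>. Hence \<open>code_nth c\<close> is the coded word
  extended by zeros and can stand in for a sequence.\<close>

definition code_nth :: "nat \<Rightarrow> nat \<Rightarrow> nat"
  where "code_nth c i = pfst (rec_nat c (\<lambda>_ y. psnd (y - 1)) i - 1)"

lemma list_decode_psnd: "list_decode (psnd (c - 1)) = tl (list_decode c)"
proof (cases c)
  case 0
  then show ?thesis by (simp add: prod_decode_0)
qed (simp split: prod.split)

lemma code_nth_drop: "list_decode (rec_nat c (\<lambda>_ y. psnd (y - 1)) i) = drop i (list_decode c)"
  by (induction i) (auto simp: list_decode_psnd[simplified] drop_Suc tl_drop)

lemma code_nth_eq: "code_nth c i = (if i < length (list_decode c) then list_decode c ! i else 0)"
proof -
  define d where "d = rec_nat c (\<lambda>_ y. psnd (y - 1)) i"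
  have d: "list_decode d = drop i (list_decode c)" unfolding d_def by (rule code_nth_drop)
  have c: "code_nth c i = pfst (d - 1)" by (simp add: code_nth_def d_def)
  show ?thesis
  proof (cases d)
    case 0
    then show ?thesis using d c by (simp add: prod_decode_0)
  next
    case (Suc m)
    then have dr: "drop i (list_decode c) = pfst m # list_decode (psnd m)" using d by (simp split: prod.splits)
    then have "i < length (list_decode c)" by (metis drop_all list.distinct(1) not_le)
    moreover from this dr have "list_decode c ! i = pfst m" by (metis hd_drop_conv_nth list.sel(1))
    ultimately show ?thesis using c Suc by simp
  qed
qed

text \<open>The code of a word thereby bounds the positions in it, so no length has to be computed
  where a bound on indices is enough.\<close>

lemma length_list_decode_le: "length (list_decode c) \<le> c"
proof (induction c rule: less_induct)
  case (less c)
  show ?case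
  proof (cases c)
    case (Suc m)
    have "psnd m \<le> m" using le_prod_encode_2[of "psnd m" "pfst m"] by simp
    with less[of "psnd m"] Suc show ?thesis by (auto split: prod.split)
  qed simp
qed

lemma recfun_code_nth: "recfun f \<Longrightarrow> recfun g \<Longrightarrow> recfun (\<lambda>x. code_nth (f x) (g x))"
  unfolding code_nth_def by (intro recfun_pfst recfun_diff recfun_rec_nat recfun_const recfun_psnd recfun_id)

lemma recfun_length: "recfun f \<Longrightarrow> recfun (\<lambda>x. length (list_decode (f x)))"
proof -
  assume f: "recfun f"
  have len: "(LEAST n. rec_nat c (\<lambda>_ y. psnd (y - 1)) n = 0) = length (list_decode c)" for c
  proof -
    have "rec_nat c (\<lambda>_ y. psnd (y - 1)) n = 0 \<longleftrightarrow> length (list_decode c) \<le> n" for n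
      using code_nth_drop[of c n] list_decode_eq[of _ 0] by (metis drop_eq_Nil list_decode.simps(1))
    then show ?thesis by (simp add: Least_equality)
  qed
  have "recfun (\<lambda>c. LEAST n. rec_nat c (\<lambda>_ y. psnd (y - 1)) n = 0)"
  proof (rule recfun_Least)
    show "\<exists>n. rec_nat c (\<lambda>_ y. psnd (y - 1)) n = 0" for c
      using code_nth_drop[of c "length (list_decode c)"] by (metis drop_all le_refl list_decode_inverse list_encode.simps(1))
  qed (intro decidable_eq recfun_rec_nat recfun_intros)
  then have "recfun (\<lambda>c. length (list_decode c))" by (simp only: len)
  from recfun_comp[OF this f] show ?thesis .
qed

lemma recfun_list_encode_map:
  assumes "recfun (\<lambda>z. h (pfst z) (psnd z))" "recfun n"
  shows "recfun (\<lambda>x. list_encode (map (\<lambda>i. h x i) [0..<n x]))"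
proof -
  have h: "recfun (\<lambda>x. h (a x) (b x))" if "recfun a" "recfun b" for a b
    using recfun_comp[OF assms(1) recfun_prod_encode[OF that]] by simp
  \<comment> \<open>List codes grow at the head, so the indices are run through downwards: step k
    puts the entry with index \<open>n x - Suc k\<close> in front.\<close>
  have "recfun (\<lambda>x. rec_nat 0 (\<lambda>k y. Suc (prod_encode (h x (n x - Suc k), y))) (n x))"
    by (intro recfun_rec_nat recfun_intros h assms(2) recfun_comp[OF assms(2)])
  moreover have "rec_nat 0 (\<lambda>k y. Suc (prod_encode (h x (m - Suc k), y))) j = list_encode (map (h x) [m - j..<m])"
    if "j \<le> m" for x j m
    using that
  proof (induction j)
    case (Suc j)
    then have "[m - Suc j..<m] = (m - Suc j) # [m - j..<m]"
      using upt_conv_Cons[of "m - Suc j" m] by (simp add: Suc_diff_Suc)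
    with Suc show ?case by simp
  qed simp
  from this[OF le_refl] have "rec_nat 0 (\<lambda>k y. Suc (prod_encode (h x (n x - Suc k), y))) (n x) =
    list_encode (map (h x) [0..<n x])" for x by simp
  ultimately show ?thesis by simp
qed

section \<open>Input prefixes and functionals given by word functions\<close>

lemma code_nth_prefix_code: "i < k \<Longrightarrow> code_nth (prefix_code p k) i = p i"
  by (simp add: code_nth_eq prefix_code_def)

lemma length_prefix_code: "length (list_decode (prefix_code p k)) = k"
  by (simp add: prefix_code_def)

lemma prefix_code_cong: "(\<And>i. i < k \<Longrightarrow> p i = q i) \<Longrightarrow> prefix_code p k = prefix_code q k"
  unfolding prefix_code_def by (rule arg_cong[of _ _ list_encode], rule map_cong) auto

lemma prefix_code_code_nth: "j \<le> k \<Longrightarrow> prefix_code (code_nth (prefix_code p k)) j = prefix_code p j"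
  by (rule prefix_code_cong) (simp add: code_nth_prefix_code)

lemma eta_eqI:
  assumes "\<And>k i. i < length (list_decode (M (prefix_code p k))) \<Longrightarrow> list_decode (M (prefix_code p k)) ! i = q i"
    and "\<And>n. \<exists>k. n < length (list_decode (M (prefix_code p k)))"
  shows "eta M p = Some q"
proof -
  have "list_decode (M (prefix_code p (LEAST k. i < length (list_decode (M (prefix_code p k)))))) ! i = q i" for i
    by (rule assms(1)) (rule LeastI_ex[OF assms(2)])
  with assms show ?thesis by (auto simp: eta_def Let_def)
qed

lemma eta_eq_Some_iff:
  "eta M p = Some q \<longleftrightarrow>
    ((\<forall>n. \<exists>k. n < length (list_decode (M (prefix_code p k)))) \<and>
     (\<forall>k k' i. i < length (list_decode (M (prefix_code p k))) \<and> i < length (list_decode (M (prefix_code p k'))) \<longrightarrow>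
        list_decode (M (prefix_code p k)) ! i = list_decode (M (prefix_code p k')) ! i)) \<and>
    (\<lambda>i. list_decode (M (prefix_code p (LEAST k. i < length (list_decode (M (prefix_code p k)))))) ! i) = q"
proof -
  have "(if P then Some x else None) = Some y \<longleftrightarrow> P \<and> x = y" for P and x y :: baire by simp
  then show ?thesis unfolding eta_def Let_def by this
qed

lemma eta_unbounded:
  assumes "eta M p = Some q"
  shows "\<exists>k. n < length (list_decode (M (prefix_code p k)))"
  using assms unfolding eta_eq_Some_iff by blast

lemma eta_nth:
  assumes eta: "eta M p = Some q" and k: "i < length (list_decode (M (prefix_code p k)))"
  shows "q i = list_decode (M (prefix_code p k)) ! i"
proof -
  let ?P = "\<lambda>k. i < length (list_decode (M (prefix_code p k)))"
  have "q i = list_decode (M (prefix_code p (Least ?P))) ! i"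
    using eta unfolding eta_eq_Some_iff by blast
  also have "\<dots> = list_decode (M (prefix_code p k)) ! i"
  proof -
    have "?P (Least ?P)" using k by (rule LeastI)
    then show ?thesis using eta k unfolding eta_eq_Some_iff by blast
  qed
  finally show ?thesis .
qed

text \<open>The places below \<open>2 * n + 2\<close> are those that \<open>pair_baire\<close>
  assigns to the entries up to n of both components. An input prefix of length k settles the first
  \<open>k div 2\<close> outputs.\<close>

lemma computable_pf_local:
  assumes local: "\<And>v v' n. (\<And>i. i < 2 * n + 2 \<Longrightarrow> v i = v' i) \<Longrightarrow> F v n = F v' n"
    and F: "recfun (\<lambda>z. F (code_nth (pfst z)) (psnd z))"
  shows "computable_pf (\<lambda>v. Some (F v))"
proof -
  define M where "M c = list_encode (map (F (code_nth c)) [0..<length (list_decode c) div 2])" for c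
  have "recfun M" unfolding M_def
    by (intro recfun_list_encode_map F recfun_div2 recfun_length recfun_id)
  moreover have "eta M v = Some (F v)" for v
  proof (rule eta_eqI)
    have M: "list_decode (M (prefix_code v k)) = map (F (code_nth (prefix_code v k))) [0..<k div 2]" for k
      by (simp add: M_def length_prefix_code)
    show "list_decode (M (prefix_code v k)) ! i = F v i"
      if "i < length (list_decode (M (prefix_code v k)))" for k i
    proof -
      have "F (code_nth (prefix_code v k)) i = F v i"
        by (rule local, rule code_nth_prefix_code) (use that M in simp)
      then show ?thesis using that by (simp add: M)
    qed
    show "\<exists>k. n < length (list_decode (M (prefix_code v k)))" for n
      unfolding M by (rule exI[of _ "2 * Suc n"]) simp
  qed
  ultimately show ?thesis unfolding computable_pf_def recfun_def by auto
qed

text \<open>The value 0 of \<open>g\<close> means that there is no answer yet, and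
  \<open>Suc a\<close> is the answer a. For a given word only its own prefixes are tried; the first
  successful one stays the same when the word grows, so the outputs are consistent. A constant
  sequence suffices because \<open>rep_nat\<close> reads the first entry only.\<close>

lemma computable_pf_search:
  assumes g: "recfun g"
  obtains H where "computable_pf H"
    "\<And>v. \<exists>s. g (prefix_code v s) \<noteq> 0 \<Longrightarrow>
      \<exists>s. g (prefix_code v s) \<noteq> 0 \<and> H v = Some (\<lambda>_. g (prefix_code v s) - 1)"
proof -
  define t where "t c = (LEAST s. g (prefix_code (code_nth c) s) \<noteq> 0 \<or> length (list_decode c) \<le> s)" for c
  define M where "M c = (if g (prefix_code (code_nth c) (t c)) \<noteq> 0
    then list_encode (map (\<lambda>i. g (prefix_code (code_nth c) (t c)) - 1) [0..<length (list_decode c)]) else 0)" for c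
  have pc: "recfun (\<lambda>x. prefix_code (code_nth (a x)) (b x))" if "recfun a" "recfun b" for a b
    unfolding prefix_code_def
    by (intro recfun_list_encode_map recfun_code_nth recfun_pfst recfun_psnd recfun_id recfun_comp[OF that(1)] that(2))
  have t: "recfun t" unfolding t_def
  proof (rule recfun_Least)
    show "\<exists>s. g (prefix_code (code_nth c) s) \<noteq> 0 \<or> length (list_decode c) \<le> s" for c by auto
  qed (intro decidable_or decidable_not decidable_eq decidable_le recfun_intros recfun_comp[OF g] pc recfun_length)
  have M: "recfun M" unfolding M_def
    by (intro recfun_if decidable_not decidable_eq recfun_comp[OF g] recfun_list_encode_map recfun_length pc recfun_intros recfun_comp[OF t])
  have "\<exists>s. g (prefix_code v s) \<noteq> 0 \<and> eta M v = Some (\<lambda>_. g (prefix_code v s) - 1)"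
    if ex: "\<exists>s. g (prefix_code v s) \<noteq> 0" for v
  proof -
    define s where "s = (LEAST s. g (prefix_code v s) \<noteq> 0)"
    have s: "g (prefix_code v s) \<noteq> 0" unfolding s_def using ex by (rule LeastI_ex)
    have less: "g (prefix_code v j) = 0" if "j < s" for j
      using that not_less_Least[of j "\<lambda>s. g (prefix_code v s) \<noteq> 0"] by (auto simp: s_def)
    have T: "t (prefix_code v k) = min s k" for k
      unfolding t_def length_prefix_code
    proof (rule Least_equality)
      show "g (prefix_code (code_nth (prefix_code v k)) (min s k)) \<noteq> 0 \<or> k \<le> min s k"
        using s by (cases "s \<le> k") (auto simp: prefix_code_code_nth min_def)
      fix y assume "g (prefix_code (code_nth (prefix_code v k)) y) \<noteq> 0 \<or> k \<le> y"
      then show "min s k \<le> y"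
        using less[of y] prefix_code_code_nth[of y k v] by (cases "k \<le> y"; cases "y < s") auto
    qed
    have Mk: "list_decode (M (prefix_code v k)) = (if s \<le> k then map (\<lambda>i. g (prefix_code v s) - 1) [0..<k] else [])" for k
      using s less by (auto simp: M_def T prefix_code_code_nth length_prefix_code min_def not_le)
    have "eta M v = Some (\<lambda>_. g (prefix_code v s) - 1)"
    proof (rule eta_eqI)
      show "\<exists>k. n < length (list_decode (M (prefix_code v k)))" for n
        by (rule exI[of _ "max s (Suc n)"]) (simp add: Mk)
    qed (simp add: Mk split: if_splits)
    then show ?thesis using s by blast
  qed
  moreover have "computable_pf (eta M)" using M unfolding computable_pf_def recfun_def by auto
  ultimately show ?thesis by (rule that[rotated])
qed

section \<open>Computable functions with rational values\<close>

lemma real_of_code_0: "real_of_code 0 = 0"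
  by (simp add: real_of_code_def prod_decode_0 int_decode_def sum_decode_def)

definition ratfun :: "(nat \<Rightarrow> real) \<Rightarrow> bool"
  where "ratfun f \<longleftrightarrow> (\<exists>g. recfun g \<and> (\<forall>x. f x = real_of_code (g x)))"

lemma ratfun_real_of_code: "recfun g \<Longrightarrow> ratfun (\<lambda>x. real_of_code (g x))"
  unfolding ratfun_def by blast

lemma ratfunI:
  assumes "recfun a" "recfun b" "recfun d" "\<And>x. d x > 0"
    "\<And>x. f x = (real (a x) - real (b x)) / real (d x)"
  shows "ratfun f"
proof -
  \<comment> \<open>\<open>int_decode\<close> sends \<open>2 * i\<close> to i and
    \<open>Suc (2 * i)\<close> to \<open>- i - 1\<close>; the denominator is coded by its
    predecessor.\<close>
  define g where "g x = prod_encode (if b x \<le> a x then 2 * (a x - b x) else Suc (2 * (b x - a x - 1)), d x - 1)" for x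
  have "recfun g" unfolding g_def by (intro recfun_intros recfun_if decidable_le assms)
  moreover have "f x = real_of_code (g x)" for x
  proof -
    have "real_of_code (g x) = (real (a x) - real (b x)) / real (Suc (d x - 1))"
      by (auto simp: real_of_code_def g_def int_decode_def sum_decode_def of_nat_diff)
    with assms show ?thesis by simp
  qed
  ultimately show ?thesis unfolding ratfun_def by blast
qed

lemma ratfunD:
  assumes "ratfun f"
  shows "\<exists>a b d. recfun a \<and> recfun b \<and> recfun d \<and>
    (\<forall>x. d x > 0 \<and> f x = (real (a x) - real (b x)) / real (d x))"
proof -
  obtain g where g: "recfun g" "\<And>x. f x = real_of_code (g x)" using assms unfolding ratfun_def by auto
  define a where "a x = (if even (pfst (g x)) then pfst (g x) div 2 else 0)" for x
  define b where "b x = (if even (pfst (g x)) then 0 else Suc (pfst (g x) div 2))" for x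
  have "recfun a" unfolding a_def by (intro recfun_if decidable_even recfun_intros recfun_div2 g)
  moreover have "recfun b" unfolding b_def by (intro recfun_if decidable_even recfun_intros recfun_div2 g)
  moreover have "recfun (\<lambda>x. Suc (psnd (g x)))" by (intro recfun_intros g)
  moreover have "f x = (real (a x) - real (b x)) / real (Suc (psnd (g x)))" for x
    by (simp add: g(2) a_def b_def real_of_code_def int_decode_def sum_decode_def split: prod.split)
  ultimately show ?thesis by blast
qed

lemma ratfun_of_nat: "recfun f \<Longrightarrow> ratfun (\<lambda>x. real (f x))"
  by (rule ratfunI[of f "\<lambda>_. 0" "\<lambda>_. 1"]) (auto intro: recfun_const)

lemma ratfun_add: "ratfun f \<Longrightarrow> ratfun g \<Longrightarrow> ratfun (\<lambda>x. f x + g x)"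
proof -
  assume f: "ratfun f" and g: "ratfun g"
  obtain a b d where f: "recfun a" "recfun b" "recfun d" "\<And>x. d x > 0"
    "\<And>x. f x = (real (a x) - real (b x)) / real (d x)" using ratfunD[OF f] by blast
  obtain a' b' d' where g: "recfun a'" "recfun b'" "recfun d'" "\<And>x. d' x > 0"
    "\<And>x. g x = (real (a' x) - real (b' x)) / real (d' x)" using ratfunD[OF g] by blast
  note * = f g
  show ?thesis
    by (rule ratfunI[of "\<lambda>x. a x * d' x + a' x * d x" "\<lambda>x. b x * d' x + b' x * d x" "\<lambda>x. d x * d' x"])
      (auto intro!: recfun_intros simp: * field_simps)
qed

lemma ratfun_mult: "ratfun f \<Longrightarrow> ratfun g \<Longrightarrow> ratfun (\<lambda>x. f x * g x)"
proof -
  assume f: "ratfun f" and g: "ratfun g"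
  obtain a b d where f: "recfun a" "recfun b" "recfun d" "\<And>x. d x > 0"
    "\<And>x. f x = (real (a x) - real (b x)) / real (d x)" using ratfunD[OF f] by blast
  obtain a' b' d' where g: "recfun a'" "recfun b'" "recfun d'" "\<And>x. d' x > 0"
    "\<And>x. g x = (real (a' x) - real (b' x)) / real (d' x)" using ratfunD[OF g] by blast
  note * = f g
  show ?thesis
    by (rule ratfunI[of "\<lambda>x. a x * a' x + b x * b' x" "\<lambda>x. a x * b' x + b x * a' x" "\<lambda>x. d x * d' x"])
      (auto intro!: recfun_intros simp: * field_simps)
qed

lemma ratfun_minus: "ratfun f \<Longrightarrow> ratfun (\<lambda>x. - f x)"
proof -
  assume f: "ratfun f"
  obtain a b d where *: "recfun a" "recfun b" "recfun d" "\<And>x. d x > 0"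
    "\<And>x. f x = (real (a x) - real (b x)) / real (d x)" using ratfunD[OF f] by blast
  show ?thesis
    by (rule ratfunI[of b a d]) (auto simp: * diff_divide_distrib)
qed

lemma ratfun_diff: "ratfun f \<Longrightarrow> ratfun g \<Longrightarrow> ratfun (\<lambda>x. f x - g x)"
  using ratfun_add[OF _ ratfun_minus, of f g] by simp

lemma ratfun_half_power: "recfun f \<Longrightarrow> ratfun (\<lambda>x. (1/2) ^ f x)"
  by (rule ratfunI[of "\<lambda>_. 1" "\<lambda>_. 0" "\<lambda>x. 2 ^ f x"]) (auto intro!: recfun_const recfun_power simp: power_divide)

lemma ratfun_power: "ratfun f \<Longrightarrow> ratfun (\<lambda>x. f x ^ n)"
proof (induction n)
  case 0
  then show ?case using ratfun_of_nat[OF recfun_const[of 1]] by simp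
qed (simp add: ratfun_mult)

text \<open>Multiplying by both positive denominators leaves a comparison of naturals. Since this is
  an exact decision, the tests on distances below are all phrased with rational quantities.\<close>

lemma decidable_less_ratfun: "ratfun f \<Longrightarrow> ratfun g \<Longrightarrow> decidable (\<lambda>x. f x < g x)"
proof -
  assume f: "ratfun f" and g: "ratfun g"
  obtain a b d where f: "recfun a" "recfun b" "recfun d" "\<And>x. d x > 0"
    "\<And>x. f x = (real (a x) - real (b x)) / real (d x)" using ratfunD[OF f] by blast
  obtain a' b' d' where g: "recfun a'" "recfun b'" "recfun d'" "\<And>x. d' x > 0"
    "\<And>x. g x = (real (a' x) - real (b' x)) / real (d' x)" using ratfunD[OF g] by blast
  note * = f g
  have "f x < g x \<longleftrightarrow> a x * d' x + b' x * d x < a' x * d x + b x * d' x" for x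
  proof -
    have "f x < g x \<longleftrightarrow> real (a x * d' x + b' x * d x) < real (a' x * d x + b x * d' x)"
      using *(4,9)[of x] by (simp add: * field_simps)
    then show ?thesis by (simp only: of_nat_less_iff)
  qed
  moreover have "decidable (\<lambda>x. a x * d' x + b' x * d x < a' x * d x + b x * d' x)"
    by (intro decidable_less recfun_intros *)
  ultimately show ?thesis by simp
qed

lemma decidable_le_ratfun: "ratfun f \<Longrightarrow> ratfun g \<Longrightarrow> decidable (\<lambda>x. f x \<le> g x)"
  using decidable_not[OF decidable_less_ratfun, of g f] by (simp add: not_less)

lemma ratfun_sum:
  assumes "ratfun (\<lambda>z. f (pfst z) (psnd z))" "recfun n"
  shows "ratfun (\<lambda>x. \<Sum>i<n x. f x i)"
proof -
  obtain g where g: "recfun g" "\<And>z. f (pfst z) (psnd z) = real_of_code (g z)"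
    using assms(1) unfolding ratfun_def by auto
  have "ratfun (\<lambda>z. real_of_code (pfst z) + real_of_code (psnd z))"
    by (intro ratfun_add ratfun_real_of_code recfun_intros)
  then obtain h where h: "recfun h" "\<And>z. real_of_code (pfst z) + real_of_code (psnd z) = real_of_code (h z)"
    unfolding ratfun_def by auto
  have "recfun (\<lambda>x. rec_nat 0 (\<lambda>k y. h (prod_encode (y, g (prod_encode (x, k))))) (n x))"
    by (intro recfun_rec_nat recfun_intros recfun_comp[OF h(1)] recfun_comp[OF g(1)] assms(2))
  moreover have "(\<Sum>i<m. f x i) = real_of_code (rec_nat 0 (\<lambda>k y. h (prod_encode (y, g (prod_encode (x, k))))) m)" for x m
  proof (induction m)
    case 0
    show ?case by (simp add: real_of_code_0)
  qed (simp add: h(2)[symmetric] g(2)[symmetric])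
  ultimately show ?thesis unfolding ratfun_def by blast
qed

lemmas ratfun_intros = ratfun_of_nat ratfun_add ratfun_mult ratfun_minus ratfun_diff ratfun_half_power
  ratfun_power ratfun_real_of_code ratfun_sum

section \<open>Searching name translations and the representations\<close>

lemma pfst_le: "pfst z \<le> z" and psnd_le: "psnd z \<le> z"
  using le_prod_encode_1[of "pfst z" "psnd z"] le_prod_encode_2[of "psnd z" "pfst z"] by simp_all

text \<open>A name of a function that outputs, at place \<open>i\<close>, the value of \<open>h\<close> at the first \<open>s\<close> with \<open>P u i s\<close>.
  Only \<open>s\<close> below the length of the prefix of \<open>u\<close> read so far are tried, which makes the word function
  total; the word ends at the first \<open>i\<close> for which the search has not succeeded yet.\<close>

definition first_hit :: "(baire \<Rightarrow> nat \<Rightarrow> nat \<Rightarrow> bool) \<Rightarrow> nat \<Rightarrow> nat \<Rightarrow> nat"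
  where "first_hit P w i = (LEAST s. length (list_decode w) \<le> s \<or> P (code_nth w) i s)"

definition search_length :: "(baire \<Rightarrow> nat \<Rightarrow> nat \<Rightarrow> bool) \<Rightarrow> nat \<Rightarrow> nat"
  where "search_length P w =
    (LEAST i. length (list_decode w) \<le> i \<or> length (list_decode w) \<le> first_hit P w i)"

definition search_word :: "(baire \<Rightarrow> nat \<Rightarrow> nat \<Rightarrow> bool) \<Rightarrow> (nat \<Rightarrow> nat) \<Rightarrow> nat \<Rightarrow> nat"
  where "search_word P h w = list_encode (map (\<lambda>i. h (first_hit P w i)) [0..<search_length P w])"

text \<open>Every index below \<open>search_length\<close> has its hit inside the word, so neither
  \<open>P\<close> nor \<open>h\<close> is consulted beyond the length. This gives the locality of
  \<open>operator_name\<close>.\<close>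

lemma search_word_cong:
  assumes P: "\<And>i s. s < length (list_decode w) \<Longrightarrow> P (code_nth w) i s = P' (code_nth w) i s"
    and h: "\<And>s. s < length (list_decode w) \<Longrightarrow> h s = h' s"
  shows "search_word P h w = search_word P' h' w"
proof -
  have "(length (list_decode w) \<le> s \<or> P (code_nth w) i s) = (length (list_decode w) \<le> s \<or> P' (code_nth w) i s)" for i s
    using P[of s i] by (cases "s < length (list_decode w)") auto
  then have f: "first_hit P w i = first_hit P' w i" for i by (simp add: first_hit_def)
  then have l: "search_length P w = search_length P' w" by (simp add: search_length_def)
  have "h (first_hit P' w i) = h' (first_hit P' w i)" if "i < search_length P' w" for i
    using not_less_Least[OF that[unfolded search_length_def]] by (intro h) auto
  then show ?thesis unfolding search_word_def f l
    by (intro arg_cong[of _ _ list_encode] map_cong) auto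
qed

text \<open>\<open>P\<close> takes a sequence, which is not a number. Decidability is therefore
  asked only for the sequences \<open>code_nth (w x)\<close> that occur.\<close>

lemma recfun_search_word:
  assumes P: "decidable (\<lambda>z. P (pfst (pfst z)) (code_nth (w (pfst (pfst z)))) (psnd (pfst z)) (psnd z))"
    and h: "recfun (\<lambda>z. h (pfst z) (psnd z))" and w: "recfun w"
  shows "recfun (\<lambda>x. search_word (P x) (h x) (w x))"
proof -
  have P': "decidable (\<lambda>z. P (a z) (code_nth (w (a z))) (b z) (c z))" if "recfun a" "recfun b" "recfun c" for a b c
    using decidable_comp[OF P recfun_prod_encode[OF recfun_prod_encode[OF that(1,2)] that(3)]] by simp
  have f: "recfun (\<lambda>x. first_hit (P (a x)) (w (a x)) (b x))" if "recfun a" "recfun b" for a b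
    unfolding first_hit_def
  proof (rule recfun_Least)
    show "decidable (\<lambda>z. length (list_decode (w (a (pfst z)))) \<le> psnd z \<or>
        P (a (pfst z)) (code_nth (w (a (pfst z)))) (b (pfst z)) (psnd z))"
      by (intro decidable_or decidable_le recfun_length recfun_comp[OF w] P' recfun_comp[OF that(1)]
          recfun_comp[OF that(2)] recfun_intros)
  qed auto
  have l: "recfun (\<lambda>x. search_length (P x) (w x))"
    unfolding search_length_def
    by (rule recfun_Least)
      (intro decidable_or decidable_le recfun_length recfun_comp[OF w] f recfun_intros, auto)
  have h': "recfun (\<lambda>z. h (a z) (b z))" if "recfun a" "recfun b" for a b
    using recfun_comp[OF h recfun_prod_encode[OF that]] by simp
  show ?thesis unfolding search_word_def
    by (intro recfun_list_encode_map h' f l recfun_intros)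
qed

lemma eta_search_word:
  assumes local: "\<And>u u' i s. (\<And>j. j \<le> s \<Longrightarrow> u j = u' j) \<Longrightarrow> P u i s = P u' i s"
    and ex: "\<And>i. \<exists>s. P u i s"
  shows "eta (search_word P h) u = Some (\<lambda>i. h (LEAST s. P u i s))"
proof -
  define g where "g i = (LEAST s. P u i s)" for i
  have g: "P u i (g i)" for i unfolding g_def using ex by (rule LeastI_ex)
  have f: "first_hit P (prefix_code u k) i = min k (g i)" for k i
    unfolding first_hit_def length_prefix_code
  proof (rule Least_equality)
    have eq: "P (code_nth (prefix_code u k)) i s = P u i s" if "s < k" for s
      by (rule local, rule code_nth_prefix_code) (use that in auto)
    show "k \<le> min k (g i) \<or> P (code_nth (prefix_code u k)) i (min k (g i))"
      using g eq[of "g i"] by (cases "g i < k") auto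
    fix s assume s: "k \<le> s \<or> P (code_nth (prefix_code u k)) i s"
    show "min k (g i) \<le> s"
    proof (cases "k \<le> s")
      case False
      then have "P u i s" using s eq by auto
      then have "g i \<le> s" unfolding g_def by (rule Least_le)
      then show ?thesis by simp
    qed simp
  qed
  have d: "list_decode (search_word P h (prefix_code u k)) =
    map (\<lambda>i. h (min k (g i))) [0..<search_length P (prefix_code u k)]" for k
    by (simp add: search_word_def f)
  have sl: "search_length P (prefix_code u k) = (LEAST i. k \<le> i \<or> k \<le> g i)" for k
    by (simp add: search_length_def length_prefix_code f)
  have less: "g i < k" if "i < search_length P (prefix_code u k)" for i k
    using not_less_Least[OF that[unfolded sl]] by auto
  have "eta (search_word P h) u = Some (\<lambda>i. h (g i))"
  proof (rule eta_eqI)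
    show "list_decode (search_word P h (prefix_code u k)) ! i = h (g i)"
      if "i < length (list_decode (search_word P h (prefix_code u k)))" for k i
      using that less[of i k] by (simp add: d)
    show "\<exists>k. n < length (list_decode (search_word P h (prefix_code u k)))" for n
    proof -
      \<comment> \<open>A prefix longer than n and than the hits of all indices up to n makes the
        first \<open>Suc n\<close> searches succeed.\<close>
      define k where "k = Suc (n + (\<Sum>i\<le>n. g i))"
      have "g i < k" if "i \<le> n" for i
        using member_le_sum[of i "{..n}" g] that by (simp add: k_def)
      then have "\<not> (k \<le> i \<or> k \<le> g i)" if "i \<le> n" for i using that by (force simp: k_def)
      moreover have "k \<le> (LEAST i. k \<le> i \<or> k \<le> g i) \<or> k \<le> g (LEAST i. k \<le> i \<or> k \<le> g i)"
        by (rule LeastI[of _ k]) simp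
      ultimately have "n < search_length P (prefix_code u k)" unfolding sl by (metis not_le)
      then show ?thesis by (auto simp: d)
    qed
  qed
  then show ?thesis by (simp add: g_def)
qed

section \<open>Density, and the conditions that define the representations\<close>

lemma half_power_less: "e > 0 \<Longrightarrow> \<exists>k. (1/2::real) ^ k < e"
  using real_arch_pow_inv[of e "1/2"] by simp

lemma real_of_code_half_power: "\<exists>r. real_of_code r = (1/2) ^ k"
proof -
  obtain g where "\<forall>x. (1/2) ^ x = real_of_code (g x)"
    using ratfun_half_power[OF recfun_id] unfolding ratfun_def by blast
  then show ?thesis by (intro exI[of _ "g k"]) simp
qed

lemma dense_approx:
  fixes \<alpha> :: "nat \<Rightarrow> 'a::metric_space"
  assumes "closure (range \<alpha>) = UNIV" "e > 0"
  shows "\<exists>c. dist (\<alpha> c) x < e"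
  using assms closure_approachable[of x "range \<alpha>"] by auto

lemma Some_The_eq_iff:
  assumes "\<And>x y. P x \<Longrightarrow> P y \<Longrightarrow> x = y"
  shows "(if \<exists>x. P x then Some (THE x. P x) else None) = Some y \<longleftrightarrow> P y"
proof -
  have "(THE x. P x) = x" if "P x" for x
    using that assms[OF _ that] by (rule the_equality)
  then show ?thesis by auto
qed

lemma cauchy_rep_eq_Some_iff: "cauchy_rep \<alpha> p = Some x \<longleftrightarrow> (\<forall>i. dist (\<alpha> (p i)) x \<le> (1/2) ^ i)"
proof -
  have "x = y" if "\<forall>i. dist (\<alpha> (p i)) x \<le> (1/2) ^ i" "\<forall>i. dist (\<alpha> (p i)) y \<le> (1/2) ^ i" for x y
  proof (rule ccontr)
    assume "x \<noteq> y"
    then obtain k where k: "(1/2::real) ^ k < dist x y / 2" using half_power_less[of "dist x y / 2"] by auto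
    have "dist x y \<le> dist (\<alpha> (p k)) x + dist (\<alpha> (p k)) y" by (rule dist_triangle3)
    also have "\<dots> \<le> (1/2) ^ k + (1/2) ^ k" using that by (intro add_mono) auto
    finally show False using k by linarith
  qed
  then show ?thesis unfolding cauchy_rep_def by (rule Some_The_eq_iff)
qed

lemma cauchy_rep_surj:
  assumes "closure (range \<alpha>) = UNIV"
  shows "\<exists>p. cauchy_rep \<alpha> p = Some x"
proof -
  have "\<exists>c. dist (\<alpha> c) x < (1/2) ^ i" for i by (rule dense_approx[OF assms]) simp
  then show ?thesis unfolding cauchy_rep_eq_Some_iff by (meson less_imp_le)
qed

lemma realizer_fun_iff:
  "realizer \<delta>X \<delta>Y (\<lambda>x. {T x}) F \<longleftrightarrow> (\<forall>p x. \<delta>X p = Some x \<longrightarrow> (\<exists>q. F p = Some q \<and> \<delta>Y q = Some (T x)))"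
  unfolding realizer_def by auto

text \<open>By density every point has a name, and a realizer determines the value at each named
  point. So \<open>q\<close> names at most one function and \<open>THE\<close> can be
  removed.\<close>

lemma rep_fun_eq_Some_iff:
  assumes "closure (range \<alpha>) = UNIV"
  shows "rep_fun (cauchy_rep \<alpha>) \<delta>Y q = Some T \<longleftrightarrow>
    continuous_on UNIV T \<and> realizer (cauchy_rep \<alpha>) \<delta>Y (\<lambda>x. {T x}) (eta q)"
proof -
  let ?P = "\<lambda>T. continuous_on UNIV T \<and> realizer (cauchy_rep \<alpha>) \<delta>Y (\<lambda>x. {T x}) (eta q)"
  have "S = T" if "?P S" "?P T" for S T
  proof
    fix x
    obtain p where "cauchy_rep \<alpha> p = Some x" using cauchy_rep_surj[OF assms] by blast
    then show "S x = T x" using that unfolding realizer_fun_iff by fastforce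
  qed
  then show ?thesis unfolding rep_fun_def by (rule Some_The_eq_iff)
qed

text \<open>Each point of \<open>A\<close> lies in arbitrarily small rational balls; these also meet
  \<open>B\<close>, so the point is in the closure of \<open>B\<close>. Used in both directions,
  this shows that a closed set is determined by the rational balls that meet it.\<close>

lemma rat_ball_hits_subset:
  assumes "closure (range \<alpha>) = UNIV" "closed B"
    "\<And>n. rat_ball \<alpha> n \<inter> A \<noteq> {} \<Longrightarrow> rat_ball \<alpha> n \<inter> B \<noteq> {}"
  shows "A \<subseteq> B"
proof
  fix x assume x: "x \<in> A"
  have "x \<in> closure B" unfolding closure_approachable
  proof (intro allI impI)
    fix e :: real assume "0 < e"
    then obtain k where k: "(1/2::real) ^ k < e / 2" using half_power_less[of "e / 2"] by auto
    obtain c where c: "dist (\<alpha> c) x < (1/2) ^ k" using dense_approx[OF assms(1), of "(1/2) ^ k" x] by auto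
    obtain r where r: "real_of_code r = (1/2) ^ k" using real_of_code_half_power by blast
    have b: "rat_ball \<alpha> (prod_encode (c, r)) = ball (\<alpha> c) ((1/2) ^ k)" by (simp add: rat_ball_def r)
    have "rat_ball \<alpha> (prod_encode (c, r)) \<inter> A \<noteq> {}" using x c by (auto simp: b)
    from assms(3)[OF this] obtain y where y: "y \<in> B" "dist (\<alpha> c) y < (1/2) ^ k" by (auto simp: b)
    have "dist y x \<le> dist (\<alpha> c) y + dist (\<alpha> c) x" by (rule dist_triangle3)
    then have "dist y x < e" using y c k by linarith
    then show "\<exists>y\<in>B. dist y x < e" using y by auto
  qed
  then show "x \<in> B" using assms(2) by simp
qed

lemma rep_Aplus_eq_Some_iff:
  assumes "closure (range \<alpha>) = UNIV"
  shows "rep_Aplus \<alpha> p = Some A \<longleftrightarrow>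
    closed A \<and> {n. Suc n \<in> range p} = {n. rat_ball \<alpha> n \<inter> A \<noteq> {}}"
proof -
  let ?P = "\<lambda>A. closed A \<and> {n. Suc n \<in> range p} = {n. rat_ball \<alpha> n \<inter> A \<noteq> {}}"
  have "A = B" if "?P A" "?P B" for A B
  proof (rule equalityI)
    show "A \<subseteq> B" using that by (intro rat_ball_hits_subset[OF assms]) blast+
    show "B \<subseteq> A" using that by (intro rat_ball_hits_subset[OF assms]) blast+
  qed
  then show ?thesis unfolding rep_Aplus_def by (rule Some_The_eq_iff)
qed

lemma dense_prod_seq:
  assumes "closure (range \<alpha>) = UNIV" "closure (range \<beta>) = UNIV"
  shows "closure (range (prod_seq \<alpha> \<beta>)) = UNIV"
proof -
  have "range (prod_seq \<alpha> \<beta>) = range \<alpha> \<times> range \<beta>"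
  proof (intro equalityI subsetI)
    fix x assume "x \<in> range \<alpha> \<times> range \<beta>"
    then obtain i j where "x = (\<alpha> i, \<beta> j)" by auto
    then have "x = prod_seq \<alpha> \<beta> (prod_encode (i, j))" by (simp add: prod_seq_def)
    then show "x \<in> range (prod_seq \<alpha> \<beta>)" by simp
  qed (auto simp: prod_seq_def split: prod.splits)
  then show ?thesis by (simp add: closure_Times assms)
qed

lemma rat_ball_prod_seq:
  "rat_ball (prod_seq \<alpha> \<beta>) n = ball (\<alpha> (pfst (pfst n)), \<beta> (psnd (pfst n))) (real_of_code (psnd n))"
  by (simp add: rat_ball_def prod_seq_def split: prod.split)

lemma computable_metric_spaceD:
  assumes "computable_metric_space \<alpha>"
  obtains d where "\<And>i j k. \<bar>d i j k - dist (\<alpha> i) (\<alpha> j)\<bar> \<le> (1/2) ^ k"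
    "\<And>a b c. recfun a \<Longrightarrow> recfun b \<Longrightarrow> recfun c \<Longrightarrow> ratfun (\<lambda>x. d (a x) (b x) (c x))"
proof -
  obtain f where f: "computable_fun 3 f" "\<And>i j k. \<bar>real_of_code (f [i, j, k]) - dist (\<alpha> i) (\<alpha> j)\<bar> \<le> (1/2) ^ k"
    using assms unfolding computable_metric_space_def computable_real_fun2_def by auto
  have "recfun (\<lambda>x. f [a x, b x, c x])" if "recfun a" "recfun b" "recfun c" for a b c
    using computable_fun_comp[of "[\<lambda>xs. a (hd xs), \<lambda>xs. b (hd xs), \<lambda>xs. c (hd xs)]" f 1] f(1) that
    by (auto simp: recfun_def numeral_3_eq_3)
  then show ?thesis
    using f(2) by (intro that[of "\<lambda>i j k. real_of_code (f [i, j, k])"]) (simp_all add: ratfun_real_of_code)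
qed

lemma CGT_graph:
  assumes "bounded_linear T"
  shows "CGT {(x, T x) | x. True} = {T}"
proof -
  have "S = T" if "{(x, T x) | x. True} = {(x, S x) | x. True}" for S
  proof
    fix x
    have "(x, T x) \<in> {(x, S x) | x. True}" unfolding that[symmetric] by blast
    then show "S x = T x" by simp
  qed
  then have "S = T" if "S \<in> CGT {(x, T x) | x. True}" for S
    using that unfolding CGT_def mem_Collect_eq by (elim conjE)
  moreover have "T \<in> CGT {(x, T x) | x. True}"
    using assms unfolding CGT_def mem_Collect_eq by (intro conjI refl)
  ultimately show ?thesis by (intro equalityI subsetI singletonI) (simp_all only: singleton_iff)
qed

lemma closed_graph:
  assumes "bounded_linear T"
  shows "closed {(x, T x) | x. True}"
proof -
  have "closed {z. T (fst z) = snd z}"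
    by (intro closed_Collect_eq continuous_on_snd continuous_on_id continuous_on_fst
        bounded_linear.continuous_on[OF assms])
  moreover have "{z. T (fst z) = snd z} = {(x, T x) | x. True}" by auto
  ultimately show ?thesis by simp
qed

section \<open>From choice to the closed graph theorem\<close>

text \<open>\<open>da\<close> and \<open>db\<close> approximate distances with error
  \<open>(1/2) ^ k\<close>. As \<open>\<alpha> 0 = 0\<close> and \<open>\<beta> 0 = 0\<close>, they
  also approximate the norms of centres, at second index 0.\<close>

locale computable_space_pair =
  fixes \<alpha> :: "nat \<Rightarrow> 'a::banach" and \<beta> :: "nat \<Rightarrow> 'b::banach"
    and da db :: "nat \<Rightarrow> nat \<Rightarrow> nat \<Rightarrow> real"
  assumes dense_a: "closure (range \<alpha>) = UNIV" and dense_b: "closure (range \<beta>) = UNIV"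
    and zero_a: "\<alpha> 0 = 0" and zero_b: "\<beta> 0 = 0"
    and da: "\<bar>da i j k - dist (\<alpha> i) (\<alpha> j)\<bar> \<le> (1/2) ^ k"
    and db: "\<bar>db i j k - dist (\<beta> i) (\<beta> j)\<bar> \<le> (1/2) ^ k"
    and ratfun_da: "recfun a \<Longrightarrow> recfun b \<Longrightarrow> recfun c \<Longrightarrow> ratfun (\<lambda>x. da (a x) (b x) (c x))"
    and ratfun_db: "recfun a \<Longrightarrow> recfun b \<Longrightarrow> recfun c \<Longrightarrow> ratfun (\<lambda>x. db (a x) (b x) (c x))"
begin

abbreviation hits_graph :: "baire \<Rightarrow> ('a \<Rightarrow> 'b) \<Rightarrow> bool" where
  "hits_graph p T \<equiv> {n. Suc n \<in> range p} = {n. rat_ball (prod_seq \<alpha> \<beta>) n \<inter> {(x, T x) | x. True} \<noteq> {}}"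

lemma hits_graphD:
  assumes "hits_graph p T" "p t \<noteq> 0"
  shows "\<exists>x. dist (\<alpha> (pfst (pfst (p t - 1)))) x < real_of_code (psnd (p t - 1)) \<and>
    dist (\<beta> (psnd (pfst (p t - 1)))) (T x) < real_of_code (psnd (p t - 1))"
proof -
  have "Suc (p t - 1) = p t" using assms(2) by simp
  then have "p t - 1 \<in> {n. Suc n \<in> range p}" by simp
  then obtain x where x: "(x, T x) \<in> rat_ball (prod_seq \<alpha> \<beta>) (p t - 1)" unfolding assms(1) by auto
  let ?c = "(\<alpha> (pfst (pfst (p t - 1))), \<beta> (psnd (pfst (p t - 1))))"
  have "dist ?c (x, T x) < real_of_code (psnd (p t - 1))" using x by (simp add: rat_ball_prod_seq)
  with dist_fst_le[of ?c "(x, T x)"] dist_snd_le[of ?c "(x, T x)"]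
  show ?thesis by (intro exI[of _ x]) simp
qed

lemma hits_graph_ex:
  assumes "hits_graph p T"
  shows "\<exists>t. p t \<noteq> 0 \<and> real_of_code (psnd (p t - 1)) = (1/2) ^ k \<and>
    dist (\<alpha> (pfst (pfst (p t - 1)))) x < (1/2) ^ k \<and> dist (\<beta> (psnd (pfst (p t - 1)))) (T x) < (1/2) ^ k"
proof -
  obtain c where c: "dist (prod_seq \<alpha> \<beta> c) (x, T x) < (1/2) ^ k"
    using dense_approx[OF dense_prod_seq[OF dense_a dense_b], of "(1/2) ^ k" "(x, T x)"] by auto
  obtain r where r: "real_of_code r = (1/2) ^ k" using real_of_code_half_power by blast
  have "(x, T x) \<in> rat_ball (prod_seq \<alpha> \<beta>) (prod_encode (c, r))" using c r by (simp add: rat_ball_def)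
  then have "prod_encode (c, r) \<in> {n. Suc n \<in> range p}" unfolding assms by blast
  then obtain t where t: "p t = Suc (prod_encode (c, r))" by (auto simp: image_iff)
  show ?thesis
    using c r dist_fst_le[of "prod_seq \<alpha> \<beta> c" "(x, T x)"] dist_snd_le[of "prod_seq \<alpha> \<beta> c" "(x, T x)"]
    by (intro exI[of _ t]) (simp add: t prod_seq_def split: prod.splits)
qed

text \<open>An entry \<open>p t = Suc n\<close> lists the ball with code \<open>n\<close>: its centre is coded by \<open>pfst n\<close>, its radius by \<open>psnd n\<close>.\<close>

definition exceeds :: "baire \<Rightarrow> nat \<Rightarrow> nat \<Rightarrow> nat \<Rightarrow> bool" where
  "exceeds p M t k \<longleftrightarrow> p t \<noteq> 0 \<and>
    real M * (da (pfst (pfst (p t - 1))) 0 k + (1/2) ^ k + real_of_code (psnd (p t - 1)))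
      < db (psnd (pfst (p t - 1))) 0 k - (1/2) ^ k - real_of_code (psnd (p t - 1))"

text \<open>For a point \<open>(x, T x)\<close> in the listed ball, the left side of the test
  over-estimates \<open>M * norm x\<close> and the right side under-estimates
  \<open>norm (T x)\<close>.\<close>

lemma exceeds_sound:
  assumes "hits_graph p T" "exceeds p M t k"
  shows "\<exists>x. norm (T x) > M * norm x"
proof -
  define a b r where "a = pfst (pfst (p t - 1))" and "b = psnd (pfst (p t - 1))" and "r = real_of_code (psnd (p t - 1))"
  note abr = a_def[symmetric] b_def[symmetric] r_def[symmetric]
  obtain x where x: "dist (\<alpha> a) x < r" "dist (\<beta> b) (T x) < r"
    using hits_graphD[OF assms(1), of t] assms(2) unfolding exceeds_def abr by blast
  have *: "M * (da a 0 k + (1/2) ^ k + r) < db b 0 k - (1/2) ^ k - r"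
    using assms(2) unfolding exceeds_def abr by blast
  have "norm x \<le> norm (\<alpha> a) + r" using x(1) norm_triangle_ineq3[of "\<alpha> a" x] by (simp add: dist_norm)
  also have "\<dots> \<le> da a 0 k + (1/2) ^ k + r" using da[of a 0 k] by (simp add: zero_a)
  finally have "M * norm x \<le> M * (da a 0 k + (1/2) ^ k + r)" by (intro mult_left_mono) auto
  also note *
  also have "db b 0 k - (1/2) ^ k - r \<le> norm (\<beta> b) - r" using db[of b 0 k] by (simp add: zero_b)
  also have "\<dots> \<le> norm (T x)" using x(2) norm_triangle_ineq3[of "\<beta> b" "T x"] by (simp add: dist_norm)
  finally show ?thesis by blast
qed

lemma exceeds_complete:
  assumes "hits_graph p T" "norm (T x) > real M * norm x"
  shows "\<exists>t k. exceeds p M t k"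
proof -
  \<comment> \<open>With radius and precision both \<open>h = (1/2) ^ k\<close>, the left side of
    the test is at most \<open>M * (norm x + 4 * h)\<close> and the right side at least
    \<open>norm (T x) - 4 * h\<close>. So \<open>h * (4 * M + 4)\<close> has to be less than the
    gap.\<close>
  obtain k where "(1/2::real) ^ k < (norm (T x) - M * norm x) / (4 * M + 4)"
    using half_power_less[of "(norm (T x) - M * norm x) / (4 * M + 4)"] assms(2) by auto
  then have k: "(1/2::real) ^ k * (4 * M + 4) < norm (T x) - M * norm x"
    by (simp add: pos_less_divide_eq)
  obtain t where "p t \<noteq> 0" "real_of_code (psnd (p t - 1)) = (1/2) ^ k"
    "dist (\<alpha> (pfst (pfst (p t - 1)))) x < (1/2) ^ k" "dist (\<beta> (psnd (pfst (p t - 1)))) (T x) < (1/2) ^ k"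
    using hits_graph_ex[OF assms(1), of k x] by blast
  note t = this
  define a b where "a = pfst (pfst (p t - 1))" and "b = psnd (pfst (p t - 1))"
  define h where "h = (1/2::real) ^ k"
  note ab = a_def[symmetric] b_def[symmetric] h_def[symmetric]
  have t': "dist (\<alpha> a) x < h" "dist (\<beta> b) (T x) < h" using t(3,4) unfolding ab by blast+
  have "da a 0 k \<le> norm (\<alpha> a) + h" using da[of a 0 k] by (simp add: zero_a h_def)
  also have "\<dots> \<le> norm x + 2 * h" using t'(1) norm_triangle_ineq3[of "\<alpha> a" x] by (simp add: dist_norm)
  finally have "M * (da a 0 k + h + h) \<le> M * (norm x + 4 * h)" by (intro mult_left_mono) auto
  also have "\<dots> < norm (T x) - 4 * h" using k by (simp add: h_def algebra_simps)
  also have "norm (T x) \<le> norm (\<beta> b) + h" using t'(2) norm_triangle_ineq3[of "\<beta> b" "T x"] by (simp add: dist_norm)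
  also have "norm (\<beta> b) \<le> db b 0 k + h" using db[of b 0 k] by (simp add: zero_b h_def)
  finally have "M * (da a 0 k + h + h) < db b 0 k - h - h" by simp
  then have "exceeds p M t k" unfolding exceeds_def t(2) ab using t(1) by blast
  then show ?thesis by blast
qed

text \<open>The index codes a position t in \<open>p\<close>, a candidate M and a precision k. All
  triples occur, and t is at most the index, which makes the functional local.\<close>

definition non_bounds :: "baire \<Rightarrow> baire" where
  "non_bounds p n = (if exceeds p (pfst (psnd n)) (pfst n) (psnd (psnd n)) then Suc (pfst (psnd n)) else 0)"

lemma computable_non_bounds: "computable_pf (\<lambda>p. Some (non_bounds p))"
proof (rule computable_pf_local)
  show "non_bounds v n = non_bounds v' n" if "\<And>i. i < 2 * n + 2 \<Longrightarrow> v i = v' i" for v v' n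
  proof -
    have "v (pfst n) = v' (pfst n)" using pfst_le[of n] by (intro that) linarith
    then show ?thesis by (simp add: non_bounds_def exceeds_def)
  qed
  show "recfun (\<lambda>z. non_bounds (code_nth (pfst z)) (psnd z))"
    unfolding non_bounds_def exceeds_def
    by (intro recfun_if decidable_and decidable_not decidable_eq decidable_less_ratfun ratfun_intros ratfun_da ratfun_db
        recfun_intros recfun_code_nth)
qed

text \<open>Thus \<open>non_bounds p\<close> is a name, by negative information, of the set of
  natural bounds of \<open>T\<close>; this is the instance handed to \<open>C_N\<close>.\<close>

lemma Suc_in_range_non_bounds:
  assumes "hits_graph p T"
  shows "Suc M \<in> range (non_bounds p) \<longleftrightarrow> (\<exists>x. norm (T x) > M * norm x)"
proof
  assume "Suc M \<in> range (non_bounds p)"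
  then obtain n where "Suc M = non_bounds p n" by auto
  then have "exceeds p M (pfst n) (psnd (psnd n))" by (auto simp: non_bounds_def split: if_splits)
  then show "\<exists>x. norm (T x) > M * norm x" by (rule exceeds_sound[OF assms])
next
  assume "\<exists>x. norm (T x) > M * norm x"
  then obtain t k where "exceeds p M t k" using exceeds_complete[OF assms] by blast
  then have "non_bounds p (prod_encode (t, prod_encode (M, k))) = Suc M" by (simp add: non_bounds_def)
  then show "Suc M \<in> range (non_bounds p)" by (metis rangeI)
qed

text \<open>The number s codes a listed ball (at position \<open>pfst s\<close>), a position in the name u of the argument and
  the precision of the distance computation.\<close>

definition close_ball :: "baire \<Rightarrow> nat \<Rightarrow> baire \<Rightarrow> nat \<Rightarrow> nat \<Rightarrow> bool" where
  "close_ball p M u i s \<longleftrightarrow> p (pfst s) \<noteq> 0 \<and>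
    real M * ((1/2) ^ pfst (psnd s) + da (u (pfst (psnd s))) (pfst (pfst (p (pfst s) - 1))) (psnd (psnd s))
      + (1/2) ^ psnd (psnd s) + real_of_code (psnd (p (pfst s) - 1))) + real_of_code (psnd (p (pfst s) - 1)) \<le> (1/2) ^ i"

text \<open>Some \<open>(y, T y)\<close> lies in the listed ball. The first bracket of the test
  bounds \<open>dist y x\<close>, by way of the approximation \<open>u j\<close> of x; multiplying
  by M bounds \<open>dist (T y) (T x)\<close>, and the last summand is the distance from
  \<open>T y\<close> to the centre.\<close>

lemma close_ball_sound:
  assumes "hits_graph p T" "close_ball p M u i s" "bounded_linear T" "\<And>x. norm (T x) \<le> M * norm x"
    "cauchy_rep \<alpha> u = Some x"
  shows "dist (\<beta> (psnd (pfst (p (pfst s) - 1)))) (T x) \<le> (1/2) ^ i"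
proof -
  define t j k where "t = pfst s" and "j = pfst (psnd s)" and "k = psnd (psnd s)"
  define a b r where "a = pfst (pfst (p t - 1))" and "b = psnd (pfst (p t - 1))" and "r = real_of_code (psnd (p t - 1))"
  note abr = t_def[symmetric] j_def[symmetric] k_def[symmetric] a_def[symmetric] b_def[symmetric] r_def[symmetric]
  obtain y where y: "dist (\<alpha> a) y < r" "dist (\<beta> b) (T y) < r"
    using hits_graphD[OF assms(1), of t] assms(2) unfolding close_ball_def abr by blast
  have *: "M * ((1/2) ^ j + da (u j) a k + (1/2) ^ k + r) + r \<le> (1/2) ^ i"
    using assms(2) unfolding close_ball_def abr by blast
  have "dist y x \<le> dist (\<alpha> (u j)) x + dist (\<alpha> (u j)) (\<alpha> a) + dist (\<alpha> a) y"
    using dist_triangle[of y x "\<alpha> a"] dist_triangle[of "\<alpha> a" x "\<alpha> (u j)"] by (simp add: dist_commute)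
  also have "\<dots> \<le> (1/2) ^ j + (da (u j) a k + (1/2) ^ k) + r"
    using assms(5) da[of "u j" a k] y(1) unfolding cauchy_rep_eq_Some_iff by (intro add_mono) (auto simp: abs_le_iff)
  finally have yx: "dist y x \<le> (1/2) ^ j + da (u j) a k + (1/2) ^ k + r" by simp
  have "dist (T y) (T x) = norm (T (y - x))"
    by (simp add: dist_norm linear_diff[OF bounded_linear.linear[OF assms(3)]])
  also have "\<dots> \<le> M * dist y x" using assms(4) by (simp add: dist_norm)
  also have "\<dots> \<le> M * ((1/2) ^ j + da (u j) a k + (1/2) ^ k + r)" using yx by (rule mult_left_mono) simp
  finally have "dist (T y) (T x) \<le> M * ((1/2) ^ j + da (u j) a k + (1/2) ^ k + r)" .
  moreover have "dist (\<beta> b) (T x) \<le> dist (\<beta> b) (T y) + dist (T y) (T x)" by (rule dist_triangle)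
  ultimately show ?thesis using y(2) * unfolding abr by linarith
qed

lemma close_ball_ex:
  assumes "hits_graph p T" "cauchy_rep \<alpha> u = Some x"
  shows "\<exists>s. close_ball p M u i s"
proof -
  \<comment> \<open>With radius, argument precision and distance precision all
    \<open>h = (1/2) ^ k\<close>, the approximate distance is at most \<open>3 * h\<close>, so the
    bracket is at most \<open>6 * h\<close> and the whole test at most
    \<open>(6 * M + 1) * h\<close>.\<close>
  obtain k where "(1/2::real) ^ k < (1/2) ^ i / (6 * M + 1)"
    using half_power_less[of "(1/2) ^ i / (6 * M + 1)"] by auto
  then have k: "(1/2::real) ^ k * (6 * M + 1) < (1/2) ^ i" by (simp add: pos_less_divide_eq)
  obtain t where "p t \<noteq> 0" and r: "real_of_code (psnd (p t - 1)) = (1/2) ^ k"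
    and t: "dist (\<alpha> (pfst (pfst (p t - 1)))) x < (1/2) ^ k"
    using hits_graph_ex[OF assms(1), of k x] by blast
  define a where "a = pfst (pfst (p t - 1))"
  define h where "h = (1/2::real) ^ k"
  have "da (u k) a k \<le> dist (\<alpha> (u k)) (\<alpha> a) + h" using da[of "u k" a k] by (simp add: h_def)
  also have "dist (\<alpha> (u k)) (\<alpha> a) \<le> dist (\<alpha> (u k)) x + dist (\<alpha> a) x" by (rule dist_triangle2)
  also have "dist (\<alpha> (u k)) x \<le> h" using assms(2) unfolding cauchy_rep_eq_Some_iff h_def by blast
  also have "dist (\<alpha> a) x \<le> h" using t by (simp add: a_def h_def)
  finally have "M * (h + da (u k) a k + h + h) \<le> M * (6 * h)" by (intro mult_left_mono) auto
  then have "M * (h + da (u k) a k + h + h) + h \<le> (1/2) ^ i"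
    using k by (simp add: h_def algebra_simps)
  then have "close_ball p M u i (prod_encode (t, prod_encode (k, k)))"
    using \<open>p t \<noteq> 0\<close> unfolding close_ball_def prod_encode_inverse fst_conv snd_conv r a_def h_def by blast
  then show ?thesis by blast
qed

text \<open>For \<open>v = pair_baire p r\<close> the even places carry \<open>p\<close>, and place
  1 carries \<open>r 0\<close>, the chosen bound. The sequence produced is itself a word function,
  to be read by \<open>eta\<close>.\<close>

definition operator_name :: "baire \<Rightarrow> baire" where
  "operator_name v = search_word (close_ball (\<lambda>t. v (2 * t)) (v 1)) (\<lambda>s. psnd (pfst (v (2 * pfst s) - 1)))"

text \<open>Entry n handles the word with code n. Its hits s are below the length of that word,
  hence below n, so \<open>p\<close> is read only at places \<open>pfst s\<close> below n.\<close>

lemma computable_operator_name: "computable_pf (\<lambda>v. Some (operator_name v))"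
proof (rule computable_pf_local)
  show "operator_name v n = operator_name v' n" if "\<And>i. i < 2 * n + 2 \<Longrightarrow> v i = v' i" for v v' n
  proof -
    have "v 1 = v' 1" by (rule that) simp
    moreover have "v (2 * pfst s) = v' (2 * pfst s)" if "s < length (list_decode n)" for s
      using pfst_le[of s] length_list_decode_le[of n] \<open>s < _\<close> by (intro \<open>\<And>i. i < 2 * n + 2 \<Longrightarrow> v i = v' i\<close>) linarith
    ultimately show ?thesis unfolding operator_name_def
      by (intro search_word_cong) (simp_all add: close_ball_def)
  qed
  show "recfun (\<lambda>z. operator_name (code_nth (pfst z)) (psnd z))"
    unfolding operator_name_def close_ball_def
    by (intro recfun_search_word decidable_and decidable_not decidable_eq decidable_le_ratfun ratfun_intros ratfun_da
        recfun_intros recfun_code_nth)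
qed

lemma rep_operator_name:
  assumes "hits_graph p T" "bounded_linear T" "\<And>x. norm (T x) \<le> r 0 * norm x"
  shows "rep_fun (cauchy_rep \<alpha>) (cauchy_rep \<beta>) (operator_name (pair_baire p r)) = Some T"
proof -
  have v: "(\<lambda>t. pair_baire p r (2 * t)) = p" "pair_baire p r 1 = r 0" "pair_baire p r (2 * t) = p t" for t
    by (simp_all add: pair_baire_def)
  have on: "operator_name (pair_baire p r) = search_word (close_ball p (r 0)) (\<lambda>s. psnd (pfst (p (pfst s) - 1)))"
    unfolding operator_name_def v ..
  have "\<exists>q. eta (operator_name (pair_baire p r)) u = Some q \<and> cauchy_rep \<beta> q = Some (T x)"
    if u: "cauchy_rep \<alpha> u = Some x" for u x
  proof (intro exI conjI)
    have ex: "\<exists>s. close_ball p (r 0) u i s" for i by (rule close_ball_ex[OF assms(1) u])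
    have loc: "close_ball p (r 0) u i s = close_ball p (r 0) u' i s"
      if "\<And>j. j \<le> s \<Longrightarrow> u j = u' j" for u u' i s
    proof -
      have "u (pfst (psnd s)) = u' (pfst (psnd s))" using pfst_le[of "psnd s"] psnd_le[of s] by (intro that) linarith
      then show ?thesis by (simp add: close_ball_def)
    qed
    show "eta (operator_name (pair_baire p r)) u =
        Some (\<lambda>i. psnd (pfst (p (pfst (LEAST s. close_ball p (r 0) u i s)) - 1)))"
      unfolding on by (rule eta_search_word[of "close_ball p (r 0)" u]) (use loc ex in blast)+
    show "cauchy_rep \<beta> (\<lambda>i. psnd (pfst (p (pfst (LEAST s. close_ball p (r 0) u i s)) - 1))) = Some (T x)"
      unfolding cauchy_rep_eq_Some_iff
    proof
      fix i
      have "close_ball p (r 0) u i (LEAST s. close_ball p (r 0) u i s)" by (rule LeastI_ex[OF ex])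
      from close_ball_sound[OF assms(1) this assms(2,3) u]
      show "dist (\<beta> (psnd (pfst (p (pfst (LEAST s. close_ball p (r 0) u i s)) - 1)))) (T x) \<le> (1/2) ^ i" .
    qed
  qed
  moreover have "continuous_on UNIV T" using bounded_linear.continuous_on[OF assms(2) continuous_on_id] .
  ultimately show ?thesis unfolding rep_fun_eq_Some_iff[OF dense_a] realizer_fun_iff by blast
qed

lemma CGT_le_C_N_of_dense:
  "weihrauch_le (rep_Aplus (prod_seq \<alpha> \<beta>)) (rep_fun (cauchy_rep \<alpha>) (cauchy_rep \<beta>)) CGT rep_Aminus_nat rep_nat C_N"
  unfolding weihrauch_le_def
proof (rule exI[of _ "\<lambda>v. Some (operator_name v)"], rule exI[of _ "\<lambda>p. Some (non_bounds p)"],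
    intro conjI allI impI computable_non_bounds computable_operator_name)
  fix G assume G: "realizer rep_Aminus_nat rep_nat C_N G"
  show "realizer (rep_Aplus (prod_seq \<alpha> \<beta>)) (rep_fun (cauchy_rep \<alpha>) (cauchy_rep \<beta>)) CGT
    (\<lambda>p. case Some (non_bounds p) of None \<Rightarrow> None
      | Some k \<Rightarrow> (case G k of None \<Rightarrow> None | Some r \<Rightarrow> Some (operator_name (pair_baire p r))))"
    unfolding realizer_def
  proof (intro allI impI)
    fix p A assume pA: "rep_Aplus (prod_seq \<alpha> \<beta>) p = Some A \<and> CGT A \<noteq> {}"
    then obtain T :: "'a \<Rightarrow> 'b" where T: "bounded_linear T" "A = {(x, T x) | x. True}" unfolding CGT_def by blast
    have hits: "hits_graph p T"
      using pA unfolding rep_Aplus_eq_Some_iff[OF dense_prod_seq[OF dense_a dense_b]] T(2) by blast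
    obtain K where K: "\<And>x. norm (T x) \<le> norm x * K" using bounded_linear.bounded[OF T(1)] by blast
    have "norm (T x) \<le> real (nat \<lceil>K\<rceil>) * norm x" for x
    proof -
      have "norm x * K \<le> norm x * real (nat \<lceil>K\<rceil>)" by (intro mult_left_mono) (auto simp: real_nat_ceiling_ge)
      with K[of x] show ?thesis by (simp add: mult.commute)
    qed
    then have "Suc (nat \<lceil>K\<rceil>) \<notin> range (non_bounds p)" unfolding Suc_in_range_non_bounds[OF hits] by (simp add: not_less)
    then have ne: "C_N {n. Suc n \<notin> range (non_bounds p)} \<noteq> {}" by (auto simp: C_N_def)
    obtain r where r: "G (non_bounds p) = Some r" "r 0 \<in> {n. Suc n \<notin> range (non_bounds p)}"
      using G[unfolded realizer_def, rule_format, of "non_bounds p", OF conjI[OF rep_Aminus_nat_def[THEN trans] ne]]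
      by (auto simp: rep_nat_def C_N_def)
    have "norm (T x) \<le> r 0 * norm x" for x
      using r(2) unfolding mem_Collect_eq Suc_in_range_non_bounds[OF hits] by (simp add: not_less)
    from rep_operator_name[of p T r, OF hits T(1) this]
    show "\<exists>q y. (case Some (non_bounds p) of None \<Rightarrow> None
      | Some k \<Rightarrow> (case G k of None \<Rightarrow> None | Some r \<Rightarrow> Some (operator_name (pair_baire p r)))) = Some q \<and>
      rep_fun (cauchy_rep \<alpha>) (cauchy_rep \<beta>) q = Some y \<and> y \<in> CGT A"
      unfolding T(2) CGT_graph[OF T(1)] using r(1) by simp
  qed
qed

end

text \<open>The empty list has code 0. Hence the sequence that is constantly 0 is a Cauchy name of
  the zero vector.\<close>

lemma dense_seq_0: "dense_seq e 0 = 0"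
  by (simp add: dense_seq_def)

theorem CGT_le_C_N:
  fixes e :: "nat \<Rightarrow> 'a::banach" and e' :: "nat \<Rightarrow> 'b::banach"
  assumes "computable_banach e" "computable_banach e'"
  shows "weihrauch_le (rep_graph e e') (rep_ops e e') CGT rep_Aminus_nat rep_nat C_N"
proof -
  have e: "computable_metric_space (dense_seq e)" "computable_metric_space (dense_seq e')"
    using assms by (auto simp: computable_banach_def)
  obtain da where da: "\<And>i j k. \<bar>da i j k - dist (dense_seq e i) (dense_seq e j)\<bar> \<le> (1/2) ^ k"
    "\<And>a b c. recfun a \<Longrightarrow> recfun b \<Longrightarrow> recfun c \<Longrightarrow> ratfun (\<lambda>x. da (a x) (b x) (c x))"
    using computable_metric_spaceD[OF e(1)] by blast
  obtain db where db: "\<And>i j k. \<bar>db i j k - dist (dense_seq e' i) (dense_seq e' j)\<bar> \<le> (1/2) ^ k"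
    "\<And>a b c. recfun a \<Longrightarrow> recfun b \<Longrightarrow> recfun c \<Longrightarrow> ratfun (\<lambda>x. db (a x) (b x) (c x))"
    using computable_metric_spaceD[OF e(2)] by blast
  interpret computable_space_pair "dense_seq e" "dense_seq e'" da db
    using e da db by unfold_locales (auto simp: computable_metric_space_def dense_seq_0)
  show ?thesis unfolding rep_graph_def rep_ops_def by (rule CGT_le_C_N_of_dense)
qed

section \<open>Computability of the Hilbert space\<close>

lemma l2_seq_zero: "l2_seq 0 n = 0" by transfer simp
lemma l2_seq_add: "l2_seq (x + y) n = l2_seq x n + l2_seq y n" by transfer simp
lemma l2_seq_scaleR: "l2_seq (c *\<^sub>R x) n = c * l2_seq x n" by transfer simp
lemma l2_seq_unit: "l2_seq (l2_unit m) n = (if n = m then 1 else 0)" by transfer simp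

lemma l2_seq_sum: "l2_seq (\<Sum>i\<in>I. f i) n = (\<Sum>i\<in>I. l2_seq (f i) n)"
  by (induction I rule: infinite_finite_induct) (simp_all add: l2_seq_zero l2_seq_add)

lemma l2_seq_sum_unit: "l2_seq (\<Sum>i<N. f i *\<^sub>R l2_unit i) n = (if n < N then f n else 0)"
  by (simp add: l2_seq_sum l2_seq_scaleR l2_seq_unit if_distrib[of "\<lambda>x. _ * x"] cong: if_cong)

text \<open>The default 0 of \<open>code_nth\<close> is the code of the rational 0, so the formula
  also covers coordinates beyond the list.\<close>

lemma l2_seq_dense_seq: "l2_seq (dense_seq l2_unit c) i = real_of_code (code_nth c i)"
  by (simp add: dense_seq_def Let_def l2_seq_sum_unit code_nth_eq real_of_code_0)

text \<open>The code of a finite vector thus bounds its support, and sums over coordinates may run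
  up to a sum of codes.\<close>

lemma code_nth_ge: "c \<le> i \<Longrightarrow> code_nth c i = 0"
  using length_list_decode_le[of c] by (simp add: code_nth_eq)

lemma dist_l2_sq: "(dist x y)\<^sup>2 = (\<Sum>i. (l2_seq x i - l2_seq y i)\<^sup>2)"
proof -
  have "(dist x y)\<^sup>2 = (\<Sum>i. (l2_seq (x - y) i)\<^sup>2)"
    unfolding dist_norm norm_l2_eq by (intro real_sqrt_pow2 suminf_nonneg l2_summable) simp
  then show ?thesis by (simp add: l2_seq_minus)
qed

lemma dist_l2_sq_finite:
  assumes "\<And>i. i \<ge> N \<Longrightarrow> l2_seq x i = 0" "\<And>i. i \<ge> N \<Longrightarrow> l2_seq y i = 0"
  shows "(dist x y)\<^sup>2 = (\<Sum>i<N. (l2_seq x i - l2_seq y i)\<^sup>2)"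
  unfolding dist_l2_sq by (rule suminf_finite) (use assms in \<open>auto simp: not_less\<close>)

lemma real_of_code_dense:
  assumes "e > 0"
  shows "\<exists>q. \<bar>real_of_code q - x\<bar> < e"
proof -
  obtain n where n: "1 / real (Suc n) < e" using nat_approx_posE[OF assms] .
  define a where "a = \<lfloor>x * real (Suc n)\<rfloor>"
  have "real_of_code (prod_encode (int_encode a, n)) = of_int a / real (Suc n)" by (simp add: real_of_code_def)
  moreover have "\<bar>of_int a / real (Suc n) - x\<bar> \<le> 1 / real (Suc n)"
  proof -
    have "\<bar>of_int a - x * real (Suc n)\<bar> \<le> 1" unfolding a_def by linarith
    then have "\<bar>of_int a - x * real (Suc n)\<bar> / real (Suc n) \<le> 1 / real (Suc n)" by (rule divide_right_mono) simp
    also have "\<bar>of_int a - x * real (Suc n)\<bar> / real (Suc n) = \<bar>(of_int a - x * real (Suc n)) / real (Suc n)\<bar>"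
      by (simp add: abs_divide)
    also have "(of_int a - x * real (Suc n)) / real (Suc n) = of_int a / real (Suc n) - x"
      by (simp add: diff_divide_distrib del: of_nat_Suc)
    finally show ?thesis .
  qed
  ultimately show ?thesis using n by (metis le_less_trans)
qed

lemma dense_seq_l2_unit: "closure (range (dense_seq l2_unit)) = UNIV"
proof -
  have "\<exists>y\<in>range (dense_seq l2_unit). dist y x < e" if e: "0 < e" for x :: l2 and e
  proof -
    have "0 < e\<^sup>2 / 2" using e by simp
    then obtain N where "norm (\<Sum>i. (l2_seq x (i + N))\<^sup>2) < e\<^sup>2 / 2"
      using suminf_exist_split[OF _ l2_summable, of "e\<^sup>2 / 2" x] by blast
    then have N: "(\<Sum>i. (l2_seq x (i + N))\<^sup>2) < e\<^sup>2 / 2" by simp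
    \<comment> \<open>The tail takes half of \<open>e\<^sup>2\<close>, and each of the first N
      coordinates at most \<open>d\<^sup>2\<close>, together at most the other half. The summand 1
      keeps d positive for \<open>N = 0\<close>.\<close>
    define d where "d = sqrt (e\<^sup>2 / (2 * (real N + 1)))"
    have d: "d > 0" "d\<^sup>2 = e\<^sup>2 / (2 * (real N + 1))" using e by (simp_all add: d_def)
    have "\<forall>i. \<exists>q. \<bar>real_of_code q - l2_seq x i\<bar> < d" using real_of_code_dense[OF d(1)] by blast
    from choice[OF this] obtain q where q: "\<And>i. \<bar>real_of_code (q i) - l2_seq x i\<bar> < d" by blast
    define c where "c = list_encode (map q [0..<N])"
    have c: "l2_seq (dense_seq l2_unit c) i = (if i < N then real_of_code (q i) else 0)" for i
      by (simp add: l2_seq_dense_seq code_nth_eq c_def real_of_code_0)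
    let ?f = "\<lambda>i. (l2_seq (dense_seq l2_unit c) i - l2_seq x i)\<^sup>2"
    have "summable ?f" using l2_summable[of "dense_seq l2_unit c - x"] by (simp add: l2_seq_minus)
    then have "(dist (dense_seq l2_unit c) x)\<^sup>2 = (\<Sum>i. ?f (i + N)) + (\<Sum>i<N. ?f i)"
      unfolding dist_l2_sq by (rule suminf_split_initial_segment)
    also have "(\<Sum>i. ?f (i + N)) < e\<^sup>2 / 2" using N by (simp add: c)
    also have "(\<Sum>i<N. ?f i) \<le> (\<Sum>i<N. d\<^sup>2)"
    proof (rule sum_mono)
      fix i assume "i \<in> {..<N}"
      then show "?f i \<le> d\<^sup>2" using q[of i] d(1) by (simp add: c abs_le_square_iff[symmetric])
    qed
    also have "(\<Sum>i<N. d\<^sup>2) \<le> e\<^sup>2 / 2" by (simp add: d(2) field_simps)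
    finally have "(dist (dense_seq l2_unit c) x)\<^sup>2 < e\<^sup>2" by simp
    then have "dist (dense_seq l2_unit c) x < e" using e by (simp add: power2_less_imp_less)
    then show ?thesis by blast
  qed
  then show ?thesis by (auto simp: closure_approachable)
qed

text \<open>The search finds the integer part of \<open>2 ^ k * sqrt (v x)\<close> by comparing
  squares only. Dividing it by \<open>2 ^ k\<close> leaves an error of at most
  \<open>(1/2) ^ k\<close>.\<close>

lemma recfun_sqrt:
  assumes v: "ratfun v" "\<And>x. v x \<ge> 0"
  shows "\<exists>f. recfun f \<and> (\<forall>x k. \<bar>real_of_code (f (prod_encode (x, k))) - sqrt (v x)\<bar> \<le> (1/2) ^ k)"
proof -
  define m where "m z = (LEAST m. v (pfst z) * 4 ^ psnd z < (real (Suc m))\<^sup>2)" for z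
  have ex: "\<exists>m. y < (real (Suc m))\<^sup>2" for y
  proof -
    obtain m where "y < real m" using reals_Archimedean2 by blast
    also have "real m \<le> (real (Suc m))\<^sup>2" by (simp add: power2_eq_square algebra_simps)
    finally show ?thesis by blast
  qed
  obtain c where c: "recfun c" "v = (\<lambda>x. real_of_code (c x))" using v(1) unfolding ratfun_def by blast
  have pow: "(4::real) ^ k = real (4 ^ k)" for k by simp
  have "recfun m" unfolding m_def pow c(2)
    by (intro recfun_Least decidable_less_ratfun ratfun_intros recfun_comp[OF c(1)] recfun_intros recfun_power)
      (rule ex)
  then have "ratfun (\<lambda>z. real (m z) * (1/2) ^ psnd z)" by (intro ratfun_intros recfun_intros)
  then obtain f where f: "recfun f" "\<And>z. real (m z) * (1/2) ^ psnd z = real_of_code (f z)"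
    unfolding ratfun_def by blast
  have "\<bar>real_of_code (f (prod_encode (x, k))) - sqrt (v x)\<bar> \<le> (1/2) ^ k" for x k
  proof -
    define j where "j = m (prod_encode (x, k))"
    have j: "j = (LEAST m. v x * 4 ^ k < (real (Suc m))\<^sup>2)" by (simp add: j_def m_def)
    have up: "v x * 4 ^ k < (real (Suc j))\<^sup>2" unfolding j by (rule LeastI_ex) (rule ex)
    have low: "(real j)\<^sup>2 \<le> v x * 4 ^ k"
    proof (cases j)
      case (Suc i)
      then have "i < (LEAST m. v x * 4 ^ k < (real (Suc m))\<^sup>2)" using j by simp
      from not_less_Least[OF this] show ?thesis using Suc by simp
    qed (simp add: v)
    have s: "sqrt (v x * 4 ^ k) = sqrt (v x) * 2 ^ k"
      using real_sqrt_power[of 4 k] by (simp add: real_sqrt_mult)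
    have "real j \<le> sqrt (v x) * 2 ^ k" using real_sqrt_le_mono[OF low] s by simp
    moreover have "sqrt (v x) * 2 ^ k \<le> real j + 1" using real_sqrt_less_mono[OF up] s by simp
    ultimately have "\<bar>real j - sqrt (v x) * 2 ^ k\<bar> \<le> 1" by simp
    then have "\<bar>real j - sqrt (v x) * 2 ^ k\<bar> * (1/2) ^ k \<le> 1 * (1/2) ^ k" by (rule mult_right_mono) simp
    also have "\<bar>real j - sqrt (v x) * 2 ^ k\<bar> * (1/2) ^ k = \<bar>(real j - sqrt (v x) * 2 ^ k) * (1/2) ^ k\<bar>"
      by (simp add: abs_mult)
    also have "(real j - sqrt (v x) * 2 ^ k) * (1/2) ^ k = real j * (1/2) ^ k - sqrt (v x)"
      by (simp add: power_divide diff_divide_distrib)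
    finally show ?thesis using f(2)[of "prod_encode (x, k)"] by (simp add: j_def)
  qed
  with f(1) show ?thesis by blast
qed

text \<open>Squared distances of coded vectors are exact rationals, so only a square root remains to
  be approximated.\<close>

lemma dist_dense_seq_l2:
  "(dist (dense_seq l2_unit a) (dense_seq l2_unit b))\<^sup>2 =
    (\<Sum>i<a + b. (real_of_code (code_nth a i) - real_of_code (code_nth b i))\<^sup>2)"
  by (subst dist_l2_sq_finite[of "a + b"]) (simp_all add: l2_seq_dense_seq code_nth_ge real_of_code_0)

theorem computable_banach_l2: "computable_banach l2_unit"
  unfolding computable_banach_def
proof
  have "range (dense_seq l2_unit) \<subseteq> span (range l2_unit)"
    unfolding dense_seq_def Let_def by (intro image_subsetI span_sum span_scale span_base rangeI)
  then show "closure (span (range l2_unit)) = UNIV" using closure_mono dense_seq_l2_unit by blast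
  define v where "v z = (\<Sum>i<pfst z + psnd z. (real_of_code (code_nth (pfst z) i) - real_of_code (code_nth (psnd z) i))\<^sup>2)" for z
  have "ratfun v" unfolding v_def by (intro ratfun_intros recfun_intros recfun_code_nth)
  moreover have "v x \<ge> 0" for x unfolding v_def by (rule sum_nonneg) simp
  ultimately obtain f where f: "recfun f" "\<And>x k. \<bar>real_of_code (f (prod_encode (x, k))) - sqrt (v x)\<bar> \<le> (1/2) ^ k"
    using recfun_sqrt[of v] by blast
  have d: "dist (dense_seq l2_unit a) (dense_seq l2_unit b) = sqrt (v (prod_encode (a, b)))" for a b
    using dist_dense_seq_l2[of a b, symmetric] by (simp add: v_def)
  have "computable_fun 3 (\<lambda>xs. f (prod_encode (prod_encode (xs ! 0, xs ! 1), xs ! 2)))"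
    by (intro recfun_computable_fun[OF f(1)] computable_fun_binary[OF computable_fun_prod_encode] computable_fun_nth) auto
  then show "computable_metric_space (dense_seq l2_unit)"
    unfolding computable_metric_space_def computable_real_fun2_def using dense_seq_l2_unit f(2)
    by (intro conjI exI[of _ "\<lambda>xs. f (prod_encode (prod_encode (xs ! 0, xs ! 1), xs ! 2))"]) (simp_all add: d)
qed

section \<open>From the closed graph theorem to choice\<close>

definition stage :: "baire \<Rightarrow> nat \<Rightarrow> nat"
  where "stage p n = (LEAST m. \<forall>i<n. p i \<noteq> Suc m)"

definition weight :: "baire \<Rightarrow> nat \<Rightarrow> nat"
  where "weight p n = (if stage p n \<noteq> stage p (Suc n) then n else 0)"

lemma stage_ex:
  fixes p :: baire
  shows "\<exists>m. \<forall>i<n. p i \<noteq> Suc m"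
proof (intro exI allI impI)
  fix i assume "i < n"
  then have "p i \<le> (\<Sum>i<n. p i)" by (intro member_le_sum) auto
  then show "p i \<noteq> Suc (\<Sum>i<n. p i)" by simp
qed

lemma stage_cong: "(\<And>i. i < n \<Longrightarrow> p i = q i) \<Longrightarrow> stage p n = stage q n"
  by (simp add: stage_def)

lemma recfun_stage:
  assumes "recfun (\<lambda>z. p (pfst z) (psnd z))" "recfun n"
  shows "recfun (\<lambda>x. stage (p x) (n x))"
proof -
  have p: "recfun (\<lambda>x. p (a x) (b x))" if "recfun a" "recfun b" for a b
    using recfun_comp[OF assms(1) recfun_prod_encode[OF that]] by simp
  show ?thesis unfolding stage_def
    by (intro recfun_Least decidable_All_less decidable_not decidable_eq p recfun_intros recfun_comp[OF assms(2)] stage_ex)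
qed

lemma recfun_weight:
  assumes "recfun (\<lambda>z. p (pfst z) (psnd z))" "recfun n"
  shows "recfun (\<lambda>x. weight (p x) (n x))"
  unfolding weight_def
  by (intro recfun_if decidable_not decidable_eq recfun_stage assms recfun_intros)

text \<open>If the constant value were excluded by some entry, it could not be the stage at any
  later time.\<close>

lemma stage_stable:
  assumes "\<And>n. N \<le> n \<Longrightarrow> stage p n = stage p (Suc n)"
  shows "Suc (stage p N) \<notin> range p"
proof
  have st: "stage p n = stage p N" if "N \<le> n" for n
    using that by (induction n rule: dec_induct) (simp_all add: assms[symmetric])
  assume "Suc (stage p N) \<in> range p"
  then obtain i where i: "p i = Suc (stage p N)" by auto
  have "\<forall>j<max N (Suc i). p j \<noteq> Suc (stage p (max N (Suc i)))"
    unfolding stage_def by (rule LeastI_ex[OF stage_ex])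
  then show False using i st[of "max N (Suc i)"] by (auto simp: less_max_iff_disj)
qed

text \<open>Below the least solution there are finitely many numbers, and each of them is excluded
  by some entry. After the last of these entries the stage is that solution for good.\<close>

lemma weight_eventually_0:
  assumes "Suc m \<notin> range p"
  shows "\<exists>N. \<forall>n\<ge>N. weight p n = 0"
proof -
  define m0 where "m0 = (LEAST m. Suc m \<notin> range p)"
  have m0: "Suc m0 \<notin> range p" unfolding m0_def using assms by (rule LeastI)
  have "\<forall>j. \<exists>i. j < m0 \<longrightarrow> p i = Suc j"
    using not_less_Least unfolding m0_def by (metis (mono_tags, lifting) rangeE)
  from choice[OF this] obtain f where f: "\<And>j. j < m0 \<Longrightarrow> p (f j) = Suc j" by blast
  define N where "N = Suc (\<Sum>j<m0. f j)"
  have "stage p n = m0" if n: "N \<le> n" for n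
    unfolding stage_def
  proof (rule Least_equality)
    show "\<forall>i<n. p i \<noteq> Suc m0" using m0 by (metis rangeI)
    fix y assume y: "\<forall>i<n. p i \<noteq> Suc y"
    show "m0 \<le> y"
    proof (rule ccontr)
      assume "\<not> m0 \<le> y"
      then have "y < m0" by simp
      then have "f y \<le> (\<Sum>j<m0. f j)" by (intro member_le_sum) auto
      then show False using y f[OF \<open>y < m0\<close>] n by (auto simp: N_def)
    qed
  qed
  then show ?thesis by (auto simp: weight_def intro!: exI[of _ N])
qed

section \<open>Diagonal operators with finitely many weights and the enumeration of their
  graphs\<close>

definition diag :: "nat \<Rightarrow> (nat \<Rightarrow> nat) \<Rightarrow> l2 \<Rightarrow> l2"
  where "diag N w x = (\<Sum>i<N. (real (w i) * l2_seq x i) *\<^sub>R l2_unit i)"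

lemma bounded_linear_l2_seq: "bounded_linear (\<lambda>x. l2_seq x i)"
  by (rule bounded_linear_intro[of _ 1]) (simp_all add: l2_seq_add l2_seq_scaleR l2_coord_le)

lemma bounded_linear_diag: "bounded_linear (diag N w)"
  unfolding diag_def
  by (intro bounded_linear_sum bounded_linear_compose[OF bounded_linear_scaleR_left]
      bounded_linear_compose[OF bounded_linear_mult_right bounded_linear_l2_seq])

lemma l2_seq_diag:
  assumes "\<forall>n\<ge>N. w n = 0"
  shows "l2_seq (diag N w x) n = real (w n) * l2_seq x n"
  using assms by (simp add: diag_def l2_seq_sum_unit not_less)

text \<open>Squared form of a distance in the product metric, so that the test is exact; the sign of
  the radius is lost in squaring and is tested separately. The coordinates of the vector coded by z
  vanish from z on, so later weights have no influence and no bound N beyond which the weights are 0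
  enters.\<close>

definition meets :: "baire \<Rightarrow> nat \<Rightarrow> nat \<Rightarrow> bool" where
  "meets p n z \<longleftrightarrow> 0 < real_of_code (psnd n) \<and>
    (\<Sum>i<z + pfst (pfst n). (real_of_code (code_nth z i) - real_of_code (code_nth (pfst (pfst n)) i))\<^sup>2)
    + (\<Sum>i<z + psnd (pfst n). (real (weight p i) * real_of_code (code_nth z i) - real_of_code (code_nth (psnd (pfst n)) i))\<^sup>2)
    < (real_of_code (psnd n))\<^sup>2"

lemma meets_iff:
  assumes w: "\<forall>n\<ge>N. weight p n = 0"
  shows "meets p n z \<longleftrightarrow>
    (dense_seq l2_unit z, diag N (weight p) (dense_seq l2_unit z)) \<in> rat_ball (prod_seq (dense_seq l2_unit) (dense_seq l2_unit)) n"
proof -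
  let ?a = "dense_seq l2_unit"
  define c d r where "c = pfst (pfst n)" and "d = psnd (pfst n)" and "r = real_of_code (psnd n)"
  have 1: "(dist (?a c) (?a z))\<^sup>2 = (\<Sum>i<z + c. (real_of_code (code_nth z i) - real_of_code (code_nth c i))\<^sup>2)"
    unfolding dist_commute[of "?a c"] by (rule dist_dense_seq_l2)
  have 2: "(dist (?a d) (diag N (weight p) (?a z)))\<^sup>2 =
    (\<Sum>i<z + d. (real (weight p i) * real_of_code (code_nth z i) - real_of_code (code_nth d i))\<^sup>2)"
    unfolding dist_commute[of "?a d"]
    by (subst dist_l2_sq_finite[of "z + d"])
      (simp_all add: l2_seq_diag[OF w] l2_seq_dense_seq code_nth_ge real_of_code_0)
  have s: "sqrt y < r \<longleftrightarrow> 0 < r \<and> y < r\<^sup>2" if "y \<ge> 0" for y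
    by (metis real_sqrt_ge_zero real_sqrt_less_iff real_sqrt_unique le_less_trans less_imp_le that)
  have "(?a z, diag N (weight p) (?a z)) \<in> rat_ball (prod_seq ?a ?a) n \<longleftrightarrow>
    sqrt ((dist (?a c) (?a z))\<^sup>2 + (dist (?a d) (diag N (weight p) (?a z)))\<^sup>2) < r"
    by (simp add: rat_ball_prod_seq dist_Pair_Pair c_def d_def r_def)
  also have "\<dots> \<longleftrightarrow> 0 < r \<and> (dist (?a c) (?a z))\<^sup>2 + (dist (?a d) (diag N (weight p) (?a z)))\<^sup>2 < r\<^sup>2"
    by (rule s) simp
  finally show ?thesis unfolding meets_def 1 2 c_def[symmetric] d_def[symmetric] r_def[symmetric] by blast
qed

definition graph_name :: "baire \<Rightarrow> baire"
  where "graph_name p m = (if meets p (pfst m) (psnd m) then Suc (pfst m) else 0)"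

lemma computable_graph_name: "computable_pf (\<lambda>p. Some (graph_name p))"
proof (rule computable_pf_local)
  show "graph_name v n = graph_name v' n" if v: "\<And>i. i < 2 * n + 2 \<Longrightarrow> v i = v' i" for v v' n
  proof -
    have "weight v i = weight v' i" if "i < psnd n + psnd (pfst (pfst n))" for i
    proof -
      \<comment> \<open>Each of the two codes bounding the sum is at most n.
        \<open>stage v (Suc i)\<close> reads places up to i, which the modulus
        \<open>2 * n + 2\<close> of \<open>computable_pf_local\<close> covers.\<close>
      have "i \<le> 2 * n" using that psnd_le[of n] psnd_le[of "pfst (pfst n)"] pfst_le[of n] pfst_le[of "pfst n"] by linarith
      then have "stage v i = stage v' i" "stage v (Suc i) = stage v' (Suc i)"
        by (auto intro!: stage_cong v)
      then show ?thesis by (simp add: weight_def)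
    qed
    then show ?thesis by (simp add: graph_name_def meets_def)
  qed
  have w: "recfun (\<lambda>z. weight (code_nth (a z)) (b z))" if "recfun a" "recfun b" for a b
    by (intro recfun_weight recfun_code_nth recfun_comp[OF that(1)] recfun_intros that(2))
  have r0: "ratfun (\<lambda>_. 0)" using ratfun_of_nat[OF recfun_const[of 0]] by simp
  show "recfun (\<lambda>z. graph_name (code_nth (pfst z)) (psnd z))"
    unfolding graph_name_def meets_def
    by (intro recfun_if decidable_and decidable_less_ratfun r0 ratfun_intros recfun_code_nth w recfun_intros)
qed

text \<open>The points whose image under \<open>x \<mapsto> (x, T x)\<close> lies in a given ball
  form an open set, as the operator is continuous. If that set is nonempty, it contains a coded
  vector, which \<open>graph_name\<close> eventually tries.\<close>

lemma rep_graph_name: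
  assumes w: "\<forall>n\<ge>N. weight p n = 0"
  shows "rep_graph l2_unit l2_unit (graph_name p) = Some {(x, diag N (weight p) x) | x. True}"
  unfolding rep_graph_def rep_Aplus_eq_Some_iff[OF dense_prod_seq[OF dense_seq_l2_unit dense_seq_l2_unit]]
proof (intro conjI closed_graph bounded_linear_diag)
  let ?T = "diag N (weight p)" and ?a = "dense_seq l2_unit"
  have "Suc n \<in> range (graph_name p) \<longleftrightarrow> rat_ball (prod_seq ?a ?a) n \<inter> {(x, ?T x) | x. True} \<noteq> {}" for n
  proof
    assume "Suc n \<in> range (graph_name p)"
    then obtain m where "Suc n = graph_name p m" by auto
    then have "meets p n (psnd m)" by (auto simp: graph_name_def split: if_splits)
    then show "rat_ball (prod_seq ?a ?a) n \<inter> {(x, ?T x) | x. True} \<noteq> {}" unfolding meets_iff[OF w] by blast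
  next
    assume "rat_ball (prod_seq ?a ?a) n \<inter> {(x, ?T x) | x. True} \<noteq> {}"
    then obtain x where x: "(x, ?T x) \<in> rat_ball (prod_seq ?a ?a) n" by blast
    have "open (rat_ball (prod_seq ?a ?a) n)" by (simp add: rat_ball_prod_seq)
    moreover have "continuous_on UNIV (\<lambda>x. (x, ?T x))"
      by (intro continuous_on_Pair continuous_on_id bounded_linear.continuous_on[OF bounded_linear_diag])
    ultimately have "open ((\<lambda>x. (x, ?T x)) -` rat_ball (prod_seq ?a ?a) n)" by (rule open_vimage)
    moreover have "x \<in> (\<lambda>x. (x, ?T x)) -` rat_ball (prod_seq ?a ?a) n" using x by simp
    ultimately obtain e where e: "e > 0" "ball x e \<subseteq> (\<lambda>x. (x, ?T x)) -` rat_ball (prod_seq ?a ?a) n"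
      using open_contains_ball by blast
    obtain z where "dist (?a z) x < e" using dense_approx[OF dense_seq_l2_unit e(1)] by blast
    then have "?a z \<in> ball x e" by (simp add: dist_commute)
    then have "meets p n z" using e(2) unfolding meets_iff[OF w] by blast
    then have "graph_name p (prod_encode (n, z)) = Suc n" by (simp add: graph_name_def)
    then show "Suc n \<in> range (graph_name p)" by (metis rangeI)
  qed
  then show "{n. Suc n \<in> range (graph_name p)} = {n. rat_ball (prod_seq ?a ?a) n \<inter> {(x, ?T x) | x. True} \<noteq> {}}"
    by blast
qed

section \<open>From a name of the operator to a final stage\<close>

abbreviation zeros :: "nat \<Rightarrow> nat" where "zeros k \<equiv> prefix_code (\<lambda>_. 0) k"

text \<open>A nonempty word after k zeros fixes the first output. It is then within 1 of the value
  at 0 and of the value at \<open>(1/2) ^ k *\<^sub>R l2_unit n\<close>, since that vector has a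
  name starting with k zeros. So the latter value has norm at most 2, and its n-th coordinate is the
  weight times \<open>(1/2) ^ k\<close>.\<close>

lemma weight_bound:
  assumes w: "\<forall>n\<ge>N. weight p n = 0" and r: "rep_ops l2_unit l2_unit r = Some (diag N (weight p))"
    and k: "r (zeros k) \<noteq> 0"
  shows "weight p n \<le> 2 ^ Suc k"
proof -
  let ?T = "diag N (weight p)" and ?a = "dense_seq l2_unit"
  have name: "\<exists>q. eta r u = Some q \<and> cauchy_rep ?a q = Some (?T x)" if "cauchy_rep ?a u = Some x" for u x
    using r that unfolding rep_ops_def rep_fun_eq_Some_iff[OF dense_seq_l2_unit] realizer_fun_iff by blast
  define x where "x = (1/2) ^ k *\<^sub>R l2_unit n"
  have nx: "norm x = (1/2) ^ k"
  proof -
    have "(\<Sum>i. (l2_seq (l2_unit n) i)\<^sup>2) = (\<Sum>i\<in>{n}. (l2_seq (l2_unit n) i)\<^sup>2)"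
      by (rule suminf_finite) (auto simp: l2_seq_unit)
    then have "norm (l2_unit n) = 1" by (simp add: norm_l2_eq l2_seq_unit)
    then show ?thesis by (simp add: x_def)
  qed
  obtain u where u: "cauchy_rep ?a u = Some x" using cauchy_rep_surj[OF dense_seq_l2_unit] by blast
  \<comment> \<open>Replacing the first k entries by 0 keeps a name of x, because the distance from
    0 to x is \<open>(1/2) ^ k\<close>, below the tolerance at each of these places.\<close>
  define u' where "u' i = (if i < k then 0 else u i)" for i
  have "cauchy_rep ?a u' = Some x"
    unfolding cauchy_rep_eq_Some_iff
  proof
    fix i
    show "dist (?a (u' i)) x \<le> (1/2) ^ i"
    proof (cases "i < k")
      case True
      then have "(1/2::real) ^ k \<le> (1/2) ^ i" by (intro power_decreasing) auto
      with True show ?thesis by (simp add: u'_def dense_seq_0 nx)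
    qed (use u in \<open>simp add: u'_def cauchy_rep_eq_Some_iff\<close>)
  qed
  from name[OF this] obtain q where q: "eta r u' = Some q" "cauchy_rep ?a q = Some (?T x)" by blast
  have "cauchy_rep ?a (\<lambda>_. 0) = Some 0" by (simp add: cauchy_rep_eq_Some_iff dense_seq_0)
  from name[OF this] obtain q0 where q0: "eta r (\<lambda>_. 0) = Some q0" "cauchy_rep ?a q0 = Some (?T 0)" by blast
  have pc: "prefix_code u' k = zeros k" by (rule prefix_code_cong) (simp add: u'_def)
  have len: "0 < length (list_decode (r (zeros k)))" using k by (cases "r (zeros k)") (simp_all split: prod.split)
  have "q 0 = q0 0"
    using eta_nth[OF q(1), of 0 k] eta_nth[OF q0(1), of 0 k] len by (simp add: pc)
  moreover have "dist (?a (q 0)) (?T x) \<le> 1" using q(2) unfolding cauchy_rep_eq_Some_iff by (metis power_0)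
  moreover have "dist (?a (q0 0)) 0 \<le> 1"
    using q0(2) unfolding cauchy_rep_eq_Some_iff linear_0[OF bounded_linear.linear[OF bounded_linear_diag]] by (metis power_0)
  ultimately have "dist (?T x) 0 \<le> 1 + 1" using dist_triangle3[of "?T x" 0 "?a (q 0)"] by simp
  then have "\<bar>l2_seq (?T x) n\<bar> \<le> 2" using l2_coord_le[of "?T x" n] by simp
  then have "real (weight p n) * (1/2) ^ k \<le> 2" by (simp add: l2_seq_diag[OF w] x_def l2_seq_scaleR l2_seq_unit)
  then have "real (weight p n) \<le> real (2 ^ Suc k)" by (simp add: power_divide divide_le_eq)
  then show ?thesis by (simp only: of_nat_le_iff)
qed

text \<open>Here \<open>c\<close> codes a prefix of \<open>pair_baire p r\<close>, so \<open>code_nth c (2 * j + 1)\<close> is \<open>r j\<close>. It is \<open>0\<close> on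
  indices beyond the prefix, and \<open>r j \<noteq> 0\<close> says that the word coded by \<open>r j\<close> is nonempty.\<close>

definition ready :: "nat \<Rightarrow> nat \<Rightarrow> bool"
  where "ready c k \<longleftrightarrow> code_nth c (2 * zeros k + 1) \<noteq> 0 \<and> 2 * (2 ^ Suc k + 1) < length (list_decode c)"

definition first_ready :: "nat \<Rightarrow> nat"
  where "first_ready c = (LEAST k. length (list_decode c) \<le> k \<or> ready c k)"

text \<open>By \<open>weight_bound\<close> a change of stage at n implies
  \<open>n \<le> 2 ^ Suc k\<close>, so the stage is final from \<open>2 ^ Suc k + 1\<close> on. The
  \<open>Suc\<close> reserves 0 for the absence of an answer, as \<open>computable_pf_search\<close>
  expects.\<close>

definition final_stage :: "nat \<Rightarrow> nat"
  where "final_stage c = (if ready c (first_ready c)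
    then Suc (stage (\<lambda>i. code_nth c (2 * i)) (2 ^ Suc (first_ready c) + 1)) else 0)"

lemma recfun_final_stage: "recfun final_stage"
proof -
  have z: "recfun (\<lambda>x. zeros (a x))" if "recfun a" for a
    unfolding prefix_code_def by (intro recfun_list_encode_map recfun_const that)
  have rd: "decidable (\<lambda>x. ready (a x) (b x))" if "recfun a" "recfun b" for a b
    unfolding ready_def
    by (intro decidable_and decidable_not decidable_eq decidable_less recfun_code_nth recfun_length z recfun_power recfun_intros that)
  have f: "recfun first_ready" unfolding first_ready_def
    by (rule recfun_Least) (intro decidable_or decidable_le rd recfun_length recfun_intros, auto)
  show ?thesis unfolding final_stage_def
    by (intro recfun_if rd recfun_stage recfun_code_nth recfun_power recfun_intros recfun_comp[OF f])
qed

text \<open>The length condition in \<open>ready\<close> ensures that the stage is that of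
  \<open>p\<close> and not that of a prefix padded with zeros. Different s may produce different k;
  any k with a nonempty word is good enough, hence the existential form.\<close>

lemma final_stage_prefix:
  assumes "final_stage (prefix_code (pair_baire p r) s) \<noteq> 0"
  shows "\<exists>k. r (zeros k) \<noteq> 0 \<and> final_stage (prefix_code (pair_baire p r) s) - 1 = stage p (2 ^ Suc k + 1)"
proof -
  define c where "c = prefix_code (pair_baire p r) s"
  define k where "k = first_ready c"
  have rd: "ready c k" using assms by (auto simp: final_stage_def c_def k_def split: if_splits)
  then have "2 * zeros k + 1 < s" by (auto simp: ready_def code_nth_eq c_def length_prefix_code split: if_splits)
  then have "r (zeros k) \<noteq> 0" using rd by (simp add: ready_def c_def code_nth_prefix_code pair_baire_def)
  moreover have "stage (\<lambda>i. code_nth c (2 * i)) (2 ^ Suc k + 1) = stage p (2 ^ Suc k + 1)"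
  proof (rule stage_cong)
    fix i :: nat assume "i < 2 ^ Suc k + 1"
    then have "2 * i < s" using rd by (simp add: ready_def c_def length_prefix_code)
    then show "code_nth c (2 * i) = p i" by (simp add: c_def code_nth_prefix_code pair_baire_def)
  qed
  ultimately show ?thesis using rd by (auto simp: final_stage_def k_def c_def)
qed

lemma final_stage_ex:
  assumes "r (zeros k) \<noteq> 0"
  shows "\<exists>s. final_stage (prefix_code (pair_baire p r) s) \<noteq> 0"
proof -
  \<comment> \<open>The summands make the prefix contain the place of \<open>r (zeros k)\<close>,
    satisfy the length condition of \<open>ready\<close>, and exceed k, so that the search is not
    cut off before it reaches k.\<close>
  define s where "s = 2 * zeros k + 2 + (2 * (2 ^ Suc k + 1) + 1) + k"
  define c where "c = prefix_code (pair_baire p r) s"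
  have rd: "ready c k"
    using assms by (simp add: ready_def c_def code_nth_prefix_code length_prefix_code s_def pair_baire_def)
  have "length (list_decode c) \<le> first_ready c \<or> ready c (first_ready c)"
    unfolding first_ready_def by (rule LeastI) (use rd in blast)
  moreover have "first_ready c \<le> k" unfolding first_ready_def by (rule Least_le) (use rd in blast)
  moreover have "k < length (list_decode c)" by (simp add: c_def length_prefix_code s_def)
  ultimately have "ready c (first_ready c)" by linarith
  then show ?thesis by (auto simp: final_stage_def c_def intro!: exI[of _ s])
qed

theorem C_N_le_CGT_l2:
  "weihrauch_le rep_Aminus_nat rep_nat C_N
    (rep_graph l2_unit l2_unit) (rep_ops l2_unit l2_unit) (CGT :: (l2 \<times> l2) set \<Rightarrow> (l2 \<Rightarrow> l2) set)"
proof -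
  obtain H where H: "computable_pf H" "\<And>v. \<exists>s. final_stage (prefix_code v s) \<noteq> 0 \<Longrightarrow>
      \<exists>s. final_stage (prefix_code v s) \<noteq> 0 \<and> H v = Some (\<lambda>_. final_stage (prefix_code v s) - 1)"
    using computable_pf_search[OF recfun_final_stage] by blast
  show ?thesis
    unfolding weihrauch_le_def
  proof (rule exI[of _ H], rule exI[of _ "\<lambda>p. Some (graph_name p)"],
      intro conjI allI impI H(1) computable_graph_name)
    fix G assume G: "realizer (rep_graph l2_unit l2_unit) (rep_ops l2_unit l2_unit) (CGT :: (l2 \<times> l2) set \<Rightarrow> (l2 \<Rightarrow> l2) set) G"
    show "realizer rep_Aminus_nat rep_nat C_N
      (\<lambda>p. case Some (graph_name p) of None \<Rightarrow> None
        | Some k \<Rightarrow> (case G k of None \<Rightarrow> None | Some r \<Rightarrow> H (pair_baire p r)))"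
      unfolding realizer_def
    proof (intro allI impI)
      fix p A assume "rep_Aminus_nat p = Some A \<and> C_N A \<noteq> {}"
      then have A: "A = {n. Suc n \<notin> range p}" "A \<noteq> {}" by (auto simp: rep_Aminus_nat_def C_N_def)
      then obtain m where "Suc m \<notin> range p" by blast
      from weight_eventually_0[OF this] obtain N where w: "\<forall>n\<ge>N. weight p n = 0" by blast
      let ?T = "diag N (weight p)"
      have cgt: "CGT {(x, ?T x) | x. True} = {?T}" by (rule CGT_graph[OF bounded_linear_diag])
      have "\<exists>r y. G (graph_name p) = Some r \<and> rep_ops l2_unit l2_unit r = Some y \<and> y \<in> CGT {(x, ?T x) | x. True}"
        using G rep_graph_name[OF w] cgt unfolding realizer_def by blast
      then obtain r where r: "G (graph_name p) = Some r" "rep_ops l2_unit l2_unit r = Some ?T"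
        unfolding cgt by blast
      \<comment> \<open>Since \<open>r\<close> must produce output on this name of 0, some prefix of
        zeros receives a nonempty word, so the search of H ends.\<close>
      have "cauchy_rep (dense_seq l2_unit) (\<lambda>_. 0) = Some (0 :: l2)" by (simp add: cauchy_rep_eq_Some_iff dense_seq_0)
      then obtain q0 where "eta r (\<lambda>_. 0) = Some q0"
        using r(2) unfolding rep_ops_def rep_fun_eq_Some_iff[OF dense_seq_l2_unit] realizer_fun_iff by blast
      from eta_unbounded[OF this, of 0] obtain k0 where "0 < length (list_decode (r (zeros k0)))" by blast
      then have "r (zeros k0) \<noteq> 0" by (cases "r (zeros k0) = 0") auto
      from final_stage_ex[of r k0, OF this] have "\<exists>s. final_stage (prefix_code (pair_baire p r) s) \<noteq> 0" .
      from H(2)[OF this] obtain s where s: "final_stage (prefix_code (pair_baire p r) s) \<noteq> 0"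
        "H (pair_baire p r) = Some (\<lambda>_. final_stage (prefix_code (pair_baire p r) s) - 1)" by blast
      from final_stage_prefix[OF s(1)] obtain k where k: "r (zeros k) \<noteq> 0"
        "final_stage (prefix_code (pair_baire p r) s) - 1 = stage p (2 ^ Suc k + 1)" by blast
      have "Suc (stage p (2 ^ Suc k + 1)) \<notin> range p"
      proof (rule stage_stable)
        \<comment> \<open>A change at n would make the weight equal to n, which exceeds the bound
          \<open>2 ^ Suc k\<close>.\<close>
        fix n :: nat assume "2 ^ Suc k + 1 \<le> n"
        then show "stage p n = stage p (Suc n)"
          using weight_bound[OF w r(2) k(1), of n] by (auto simp: weight_def split: if_splits)
      qed
      then show "\<exists>q y. (case Some (graph_name p) of None \<Rightarrow> None
        | Some k \<Rightarrow> (case G k of None \<Rightarrow> None | Some r \<Rightarrow> H (pair_baire p r))) = Some q \<and>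
          rep_nat q = Some y \<and> y \<in> C_N A"
        using r(1) s(2) k(2) by (simp add: rep_nat_def C_N_def A(1))
    qed
  qed
qed

theorem theorem5p5:
  fixes e :: "nat \<Rightarrow> 'a::banach" and e' :: "nat \<Rightarrow> 'b::banach"
  assumes "computable_banach e" and "computable_banach e'"
  shows "weihrauch_le (rep_graph e e') (rep_ops e e') CGT rep_Aminus_nat rep_nat C_N
       \<and> weihrauch_eq rep_Aminus_nat rep_nat C_N
           (rep_graph l2_unit l2_unit) (rep_ops l2_unit l2_unit) (CGT :: (l2 \<times> l2) set \<Rightarrow> (l2 \<Rightarrow> l2) set)"
  unfolding weihrauch_eq_def
  using CGT_le_C_N[OF assms] C_N_le_CGT_l2 CGT_le_C_N[OF computable_banach_l2 computable_banach_l2] by blast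

end
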